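(* Let $X$ be an infinite dimensional real Banach space whose dual $X^*$ is separable. Then $K_a(X)>1$.
   Context: For a Banach space $X$, $B_X$ denotes its closed unit ball and $X^*$ its dual. For positive constants $c_1,c_2,d$, a subset $S$ of a normed space $X$ is called a $(c_1,c_2,d)$-b.s.a. (bounded and separated antipodal) subset of $X$ if (1) $\|x\|\le c_1$ for all $x\in S$, and (2) for every $x,y\in S$ with $x\ne y$ there exists $f\in X^*$ with $\|f\|\le c_2$ such that $d\le f(y)-f(x)$ and $f(x)\le f(z)\le f(y)$ for all $z\in S$. For an infinite dimensional Banach space $X$, $$K_a(X)=\sup\{d>0:\ \text{there exists an infinite } S\subseteq B_X \text{ which is a } (1,1,d)\text{-b.s.a. subset of } X\}.$$ *)

theory Defs
  imports "HOL-Analysis.Analysis"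
begin

definition infinite_dimensional :: "'a::real_vector itself \<Rightarrow> bool" where
  "infinite_dimensional _ \<longleftrightarrow> \<not> (\<exists>B :: 'a set. finite B \<and> span B = UNIV)"

text \<open>
  The dual of a real normed space \<open>'a\<close> is the type \<open>'a \<Rightarrow>\<^sub>L real\<close> with its operator norm.
  The predicate is meant for positive \<open>c1\<close>, \<open>c2\<close>, \<open>d\<close>; positivity is imposed where it is used.
\<close>

definition bsa :: "real \<Rightarrow> real \<Rightarrow> real \<Rightarrow> 'a::real_normed_vector set \<Rightarrow> bool" where
  "bsa c1 c2 d S \<longleftrightarrow>
     (\<forall>x\<in>S. norm x \<le> c1) \<and>
     (\<forall>x\<in>S. \<forall>y\<in>S. x \<noteq> y \<longrightarrow>
        (\<exists>f :: 'a \<Rightarrow>\<^sub>L real. norm f \<le> c2 \<and>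
            d \<le> blinfun_apply f y - blinfun_apply f x \<and>
            (\<forall>z\<in>S. blinfun_apply f x \<le> blinfun_apply f z \<and>
                   blinfun_apply f z \<le> blinfun_apply f y)))"

definition Ka_set :: "'a::real_normed_vector itself \<Rightarrow> real set" where
  "Ka_set _ = {d. d > 0 \<and> (\<exists>S :: 'a set. infinite S \<and> S \<subseteq> cball 0 1 \<and> bsa 1 1 d S)}"

definition Ka :: "'a::real_normed_vector itself \<Rightarrow> real" where
  "Ka X = Sup (Ka_set X)"

text \<open>
  \<^const>\<open>Sup\<close> on the reals is only meaningful for nonempty sets that are bounded above;
  boundedness holds in every normed space.
\<close>

lemma Ka_set_le_2:
  assumes "d \<in> Ka_set TYPE('a::real_normed_vector)"
  shows "d \<le> 2"
proof -
  obtain S :: "'a set" where S: "infinite S" "bsa 1 1 d S"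
    using assms by (auto simp: Ka_set_def)
  obtain x where x: "x \<in> S"
    using S(1) by fastforce
  have "infinite (S - {x})"
    using S(1) by simp
  then obtain y where y: "y \<in> S" "x \<noteq> y"
    by (metis DiffE equals0I finite.emptyI insertI1)
  obtain f :: "'a \<Rightarrow>\<^sub>L real" where f: "norm f \<le> 1" "d \<le> blinfun_apply f y - blinfun_apply f x"
    using S(2) x y unfolding bsa_def by blast
  have bound: "\<bar>blinfun_apply f z\<bar> \<le> 1" if "z \<in> S" for z
  proof -
    have "\<bar>blinfun_apply f z\<bar> \<le> norm f * norm z"
      using norm_blinfun[of f z] by simp
    also have "\<dots> \<le> 1 * 1"
      using that S(2) f(1) by (intro mult_mono) (auto simp: bsa_def)
    finally show ?thesis by simp
  qed
  show ?thesis
    using bound[OF x] bound[OF y(1)] f(2) by linarith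
qed

lemma bdd_above_Ka_set: "bdd_above (Ka_set TYPE('a::real_normed_vector))"
  using Ka_set_le_2 by (rule bdd_aboveI)

end

theory Submission
  imports Defs "HOL-Library.Ramsey"
begin

text \<open>
  Two observations carry the proof.

  \<^bold>\<open>Nearly equilateral sequences are nearly antipodal.\<close> Let all distances between distinct terms of a
  bounded sequence \<open>y\<close> lie in \<open>[D - e, D]\<close>, and let \<open>f\<close> have norm one and norm \<open>y i - y j\<close>. Then
  \<open>f (y k) - f (y j) \<le> D \<le> f (y i) - f (y j) + e\<close> for every \<open>k\<close>, and likewise from below, so \<open>y i\<close> and
  \<open>y j\<close> are extremal for \<open>f\<close> up to the error \<open>e\<close>. A small multiple of a bounded functional that singles out
  \<open>y i\<close> from above and \<open>y j\<close> from below repairs the error. Since Ramsey's theorem makes the distances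
  nearly constant along a subsequence, the constant exceeds one as soon as a ball of radius \<open>R\<close> contains a
  sequence with such functionals whose distances are at least \<open>R * (1 + \<delta>)\<close>: this is
  \<open>Ka_gt_one_if_separated\<close>.

  \<^bold>\<open>Such a sequence exists\<close>, as in the theorem of Elton and Odell on \<open>(1 + \<epsilon>)\<close>-separated sequences.
  Separability of the dual gives a normalized weakly null sequence \<open>x\<close>; it is chosen so that passing to
  an initial part of a sum increases its norm by a factor that tends to one (\<open>basic_null_sequence_exists\<close>).
  For a finite set \<open>t\<close> of indices let \<open>alt t\<close> be the sum of the \<open>x i\<close>, \<open>i \<in> t\<close>, with alternating signs.
  If \<open>s\<close> has odd size and lies to the left of \<open>t\<close>, then \<open>alt s - alt t = alt (s \<union> t)\<close>. Hence, if
  no separated sequence exists, any sequence of successive odd sets whose alternating sums are bounded by \<open>R\<close> has two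
  members whose union has an alternating sum barely larger than \<open>R\<close>. Galvin's lemma, a Ramsey principle
  for finite sets of arbitrary size, turns this into an extension property (\<open>admissible_extension\<close>): for
  \<open>1 < C' < C\<close> some odd set \<open>s\<close> can be followed by every set of a subsequence whose partial alternating
  sums are bounded by \<open>C'\<close>, at the price of the bound \<open>C\<close>. Iterating with constants decreasing to
  one gives, by Galvin's lemma again, a subsequence all of whose finite alternating sums are bounded by
  \<open>5/4\<close> (\<open>bounded_alternating_sums\<close>).

  At that point the sequence behaves like the unit vectors of \<open>c\<^sub>0\<close>, where the vectors
  \<open>- e n + (\<Sum>i<n. e i)\<close> have norm one and mutual distance two. The analogous vectors
  \<open>y n = alt (T n) - x (l (2 * n))\<close>, \<open>T n\<close> consisting of the first \<open>2 * n\<close> indices of a sparse subsequence \<open>l\<close>,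
  have norm at most \<open>3/2\<close> and distances at least \<open>9/5\<close>, so a separated sequence exists after all.
\<close>

section \<open>Functionals from sublinear bounds\<close>

definition sublinear :: "('a::real_vector \<Rightarrow> real) \<Rightarrow> bool" where
  "sublinear p \<longleftrightarrow> (\<forall>x y. p (x + y) \<le> p x + p y) \<and> (\<forall>c x. 0 \<le> c \<longrightarrow> p (c *\<^sub>R x) = c * p x)"

lemma sublinear_add: "sublinear p \<Longrightarrow> p (x + y) \<le> p x + p y"
  and sublinear_scaleR: "sublinear p \<Longrightarrow> 0 \<le> c \<Longrightarrow> p (c *\<^sub>R x) = c * p x"
  by (auto simp: sublinear_def)

lemma sublinear_zero: "sublinear p \<Longrightarrow> p 0 = 0"
  using sublinear_scaleR[of p 0 0] by simp

lemma sublinear_minus: "sublinear p \<Longrightarrow> - p (- x) \<le> p x"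
  using sublinear_add[of p x "- x"] sublinear_zero[of p] by simp

text \<open>
  The largest sublinear functional below \<open>p\<close> with values at most \<open>- b\<close> at \<open>- y\<close> is the infimum of
  \<open>p (x + y) - b\<close> over the cone; the hypothesis \<open>b \<le> p y\<close> keeps this infimum finite.
\<close>

lemma sublinear_below_cone:
  fixes p :: "'a::real_vector \<Rightarrow> real" and D :: "('a \<times> real) set"
  assumes p: "sublinear p" and D: "convex_cone D" and le: "\<And>y b. (y, b) \<in> D \<Longrightarrow> b \<le> p y"
  obtains q where "sublinear q" "q \<le> p" "\<And>y b. (y, b) \<in> D \<Longrightarrow> q (- y) \<le> - b"
proof -
  define q where "q x = (INF z\<in>D. p (x + fst z) - snd z)" for x
  have D0: "(0, 0) \<in> D" and Dadd: "\<And>z z'. z \<in> D \<Longrightarrow> z' \<in> D \<Longrightarrow> z + z' \<in> D"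
    and Dsc: "\<And>c z. 0 \<le> c \<Longrightarrow> z \<in> D \<Longrightarrow> c *\<^sub>R z \<in> D"
    using D by (auto simp: convex_cone_iff zero_prod_def)
  have low: "- p (- x) \<le> p (x + fst z) - snd z" if "z \<in> D" for x z
    using le[of "fst z" "snd z"] that sublinear_add[OF p, of "x + fst z" "- x"] by simp
  have bdd: "bdd_below ((\<lambda>z. p (x + fst z) - snd z) ` D)" for x
    using low by (auto intro!: bdd_belowI2)
  have qle: "q x \<le> p (x + y) - b" if "(y, b) \<in> D" for x y b
    unfolding q_def using cINF_lower[OF bdd that, of x] by simp
  have qge: "m \<le> q x" if "\<And>y b. (y, b) \<in> D \<Longrightarrow> m \<le> p (x + y) - b" for m x
    unfolding q_def using that D0 by (intro cINF_greatest) auto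
  have q_p: "q x \<le> p x" for x
    using qle[OF D0, of x] by simp
  have q0: "q 0 = 0"
    using qge[of 0 0] le q_p[of 0] sublinear_zero[OF p] by fastforce
  have qsc1: "q (c *\<^sub>R x) \<le> c * q x" if "0 < c" for c x
  proof -
    have "q (c *\<^sub>R x) / c \<le> q x"
    proof (rule qge)
      fix y b assume yb: "(y, b) \<in> D"
      have "(c *\<^sub>R y, c * b) \<in> D"
        using Dsc[OF _ yb, of c] that by (simp add: scaleR_prod_def)
      then have "q (c *\<^sub>R x) \<le> p (c *\<^sub>R (x + y)) - c * b"
        using qle[of "c *\<^sub>R y" "c * b" "c *\<^sub>R x"] by (simp add: scaleR_add_right)
      also have "\<dots> = c * (p (x + y) - b)"
        using that by (simp add: sublinear_scaleR[OF p] right_diff_distrib)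
      finally show "q (c *\<^sub>R x) / c \<le> p (x + y) - b"
        using that by (simp add: field_simps)
    qed
    then show ?thesis using that by (simp add: field_simps)
  qed
  have qsc: "q (c *\<^sub>R x) = c * q x" if "0 \<le> c" for c x
  proof (cases "c = 0")
    case False
    then have c: "0 < c" using that by simp
    have "q x \<le> inverse c * q (c *\<^sub>R x)"
      using qsc1[of "inverse c" "c *\<^sub>R x"] c by simp
    then have "c * q x \<le> q (c *\<^sub>R x)"
      using c by (simp add: field_simps)
    with qsc1[OF c, of x] show ?thesis by simp
  qed (simp add: q0)
  have qadd: "q (x + y) \<le> q x + q y" for x y
  proof -
    have "q (x + y) - q y \<le> q x"
    proof (rule qge)
      fix a b assume ab: "(a, b) \<in> D"
      have "q (x + y) - (p (x + a) - b) \<le> q y"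
      proof (rule qge)
        fix a' b' assume ab': "(a', b') \<in> D"
        have "(a + a', b + b') \<in> D"
          using Dadd[OF ab ab'] by simp
        then have "q (x + y) \<le> p ((x + a) + (y + a')) - (b + b')"
          using qle[of "a + a'" "b + b'" "x + y"] by (simp add: algebra_simps)
        then show "q (x + y) - (p (x + a) - b) \<le> p (y + a') - b'"
          using sublinear_add[OF p, of "x + a" "y + a'"] by simp
      qed
      then show "q (x + y) - q y \<le> p (x + a) - b" by simp
    qed
    then show ?thesis by simp
  qed
  show thesis
  proof (rule that[of q])
    show "sublinear q" using qadd qsc by (auto simp: sublinear_def)
    show "q \<le> p" using q_p by (simp add: le_fun_def)
    show "q (- y) \<le> - b" if "(y, b) \<in> D" for y b
      using qle[OF that, of "- y"] sublinear_zero[OF p] by simp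
  qed
qed

lemma convex_cone_ray:
  fixes y :: "'a::real_vector" and b :: real
  shows "convex_cone {z. \<exists>t\<ge>0. z = (t *\<^sub>R y, t * b)}"
  unfolding convex_cone_iff
proof (intro conjI ballI allI impI)
  show "0 \<in> {z. \<exists>t\<ge>0. z = (t *\<^sub>R y, t * b)}"
    by (auto simp: zero_prod_def intro!: exI[of _ 0])
next
  fix z z' assume "z \<in> {z. \<exists>t\<ge>0. z = (t *\<^sub>R y, t * b)}" "z' \<in> {z. \<exists>t\<ge>0. z = (t *\<^sub>R y, t * b)}"
  then obtain t t' where "0 \<le> t" "0 \<le> t'" "z = (t *\<^sub>R y, t * b)" "z' = (t' *\<^sub>R y, t' * b)" by auto
  then show "z + z' \<in> {z. \<exists>t\<ge>0. z = (t *\<^sub>R y, t * b)}"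
    by (auto simp: algebra_simps intro!: exI[of _ "t + t'"])
next
  fix c :: real and z assume "z \<in> {z. \<exists>t\<ge>0. z = (t *\<^sub>R y, t * b)}" "0 \<le> c"
  then obtain t where "0 \<le> t" "z = (t *\<^sub>R y, t * b)" by auto
  with \<open>0 \<le> c\<close> show "c *\<^sub>R z \<in> {z. \<exists>t\<ge>0. z = (t *\<^sub>R y, t * b)}"
    by (intro CollectI exI[of _ "c * t"]) (auto simp: scaleR_prod_def)
qed

text \<open>
  Lowering \<open>q\<close> along the ray through \<open>(y, q y)\<close> gives a sublinear functional below \<open>q\<close> whose value at \<open>- y\<close>
  is at most \<open>- q y\<close>. For a minimal \<open>q\<close> nothing changes, so \<open>q\<close> is odd, and odd sublinear functionals are linear.
\<close>

lemma minimal_sublinear_linear: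
  assumes q: "sublinear q" and min: "\<And>r. sublinear r \<Longrightarrow> r \<le> q \<Longrightarrow> r = q"
  shows "linear q"
proof -
  have neg: "q (- y) = - q y" for y
  proof -
    define D where "D = {z. \<exists>t\<ge>0. z = (t *\<^sub>R y, t * q y)}"
    have "convex_cone D" unfolding D_def by (rule convex_cone_ray)
    moreover have "b \<le> q a" if "(a, b) \<in> D" for a b
      using that by (auto simp: D_def sublinear_scaleR[OF q])
    ultimately obtain r where r: "sublinear r" "r \<le> q" "\<And>a b. (a, b) \<in> D \<Longrightarrow> r (- a) \<le> - b"
      using sublinear_below_cone[OF q] by metis
    have "(y, q y) \<in> D" by (auto simp: D_def intro!: exI[of _ 1])
    then have "q (- y) \<le> - q y"
      using r(3) min[OF r(1,2)] by blast
    then show ?thesis using sublinear_minus[OF q, of y] by linarith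
  qed
  have add: "q (x + y) = q x + q y" for x y
    using sublinear_add[OF q, of x y] sublinear_add[OF q, of "x + y" "- y"] neg[of y] by simp
  have "q (c *\<^sub>R x) = c * q x" for c x
  proof (cases "0 \<le> c")
    case False
    then have "q (- (c *\<^sub>R x)) = (- c) * q x"
      using sublinear_scaleR[OF q, of "- c" x] by simp
    then show ?thesis using neg by simp
  qed (simp add: sublinear_scaleR[OF q])
  with add show ?thesis by (intro linearI) auto
qed

text \<open>
  The Hahn--Banach theorem in its pointwise form: Zorn's lemma is applied to the sublinear functionals
  themselves, chains being bounded below by their pointwise infima, so that partially defined linear maps
  do not occur.
\<close>

lemma sublinear_dominates_linear:
  fixes p :: "'a::real_vector \<Rightarrow> real"
  assumes p: "sublinear p"
  obtains f where "linear f" "f \<le> p"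
proof -
  let ?A = "{q. sublinear q \<and> q \<le> p}"
  let ?P = "\<lambda>q r :: 'a \<Rightarrow> real. r \<le> q"
  have "\<exists>m\<in>?A. \<forall>a\<in>?A. ?P m a \<longrightarrow> a = m"
  proof (rule predicate_Zorn)
    show "partial_order_on ?A (relation_of ?P ?A)"
      by (auto simp: partial_order_on_def preorder_on_def relation_of_def refl_on_def trans_def antisym_def)
  next
    fix C assume C: "C \<in> Chains (relation_of ?P ?A)"
    show "\<exists>u\<in>?A. \<forall>a\<in>C. ?P a u"
    proof (cases "C = {}")
      case True then show ?thesis using p by auto
    next
      case False
      have CA: "sublinear c" "c \<le> p" if "c \<in> C" for c
        using C that by (auto simp: Chains_def relation_of_def)
      have Clin: "c \<le> d \<or> d \<le> c" if "c \<in> C" "d \<in> C" for c d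
        using C that by (auto simp: Chains_def relation_of_def)
      define u where "u x = (INF c\<in>C. c x)" for x
      have bdd: "bdd_below ((\<lambda>c. c x) ` C)" for x
      proof (rule bdd_belowI2)
        fix c assume "c \<in> C"
        then show "- p (- x) \<le> c x"
          using sublinear_minus[of c x] CA[of c] le_funD[of c p "- x"] by fastforce
      qed
      have ule: "u x \<le> c x" if "c \<in> C" for c x
        unfolding u_def using cINF_lower[OF bdd that] .
      have uge: "m \<le> u x" if "\<And>c. c \<in> C \<Longrightarrow> m \<le> c x" for m x
        unfolding u_def using that False by (intro cINF_greatest) auto
      have usc: "u (t *\<^sub>R x) = t * u x" if t: "0 \<le> t" for t x
      proof (cases "t = 0")
        case True
        have "u 0 = (INF c\<in>C. 0)" unfolding u_def
          using CA by (intro INF_cong) (auto simp: sublinear_zero)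
        then show ?thesis using True False by simp
      next
        case F: False
        with t have t: "0 < t" by simp
        have "u (t *\<^sub>R x) \<le> t * c x" if "c \<in> C" for c
          using ule[OF that, of "t *\<^sub>R x"] sublinear_scaleR[OF CA(1)[OF that], of t x] t by simp
        then have "u (t *\<^sub>R x) / t \<le> u x"
          using t by (intro uge) (simp add: field_simps)
        moreover have "t * u x \<le> u (t *\<^sub>R x)"
          using t ule by (intro uge) (simp add: sublinear_scaleR[OF CA(1)])
        ultimately show ?thesis using t by (simp add: field_simps)
      qed
      have uadd: "u (x + y) \<le> u x + u y" for x y
      proof -
        have 1: "u (x + y) \<le> c x + d y" if c: "c \<in> C" and d: "d \<in> C" for c d
        proof -
          obtain e where "e \<in> C" "e \<le> c" "e \<le> d"
            using Clin[OF c d] c d by blast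
          then show ?thesis
            using ule[of e "x + y"] sublinear_add[OF CA(1), of e x y] le_funD[of e c x] le_funD[of e d y]
            by linarith
        qed
        have "u (x + y) - u y \<le> u x"
        proof (rule uge)
          fix c assume c: "c \<in> C"
          have "u (x + y) - c x \<le> u y"
            by (rule uge) (use 1[OF c] in \<open>simp add: algebra_simps\<close>)
          then show "u (x + y) - u y \<le> c x" by simp
        qed
        then show ?thesis by simp
      qed
      obtain c where "c \<in> C" using False by blast
      then have "u \<le> p" using ule CA(2)[of c] by (meson le_fun_def order_trans)
      then show ?thesis
        using uadd usc ule by (intro bexI[of _ u]) (auto simp: sublinear_def le_fun_def)
    qed
  qed
  then obtain q where q: "sublinear q" "q \<le> p"
    and min: "\<And>r. sublinear r \<Longrightarrow> r \<le> p \<Longrightarrow> r \<le> q \<Longrightarrow> r = q" by blast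
  have "linear q"
    using min q(2) by (intro minimal_sublinear_linear[OF q(1)]) (meson order_trans)
  with q(2) show thesis using that by blast
qed

text \<open>
  Extension of functionals, norming functionals and separation of convex sets from balls are all
  instances of this statement, for suitable cones \<open>D\<close>.
\<close>

theorem functional_above_cone:
  fixes D :: "('a::real_normed_vector \<times> real) set"
  assumes D: "convex_cone D" and M: "0 \<le> M" and le: "\<And>y b. (y, b) \<in> D \<Longrightarrow> b \<le> M * norm y"
  obtains f :: "'a \<Rightarrow>\<^sub>L real" where "norm f \<le> M" "\<And>y b. (y, b) \<in> D \<Longrightarrow> b \<le> f y"
proof -
  have p: "sublinear (\<lambda>x::'a. M * norm x)"
    using M norm_triangle_ineq by (auto simp: sublinear_def simp flip: distrib_left intro!: mult_left_mono)
  obtain q :: "'a \<Rightarrow> real" where q: "sublinear q" "q \<le> (\<lambda>x. M * norm x)"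
      "\<And>y b. (y, b) \<in> D \<Longrightarrow> q (- y) \<le> - b"
    using sublinear_below_cone[OF p D le] by metis
  obtain f where f: "linear f" "f \<le> q" using sublinear_dominates_linear[OF q(1)] by blast
  have fle: "f x \<le> M * norm x" for x
    using le_funD[OF f(2), of x] le_funD[OF q(2), of x] by simp
  have fbd: "\<bar>f x\<bar> \<le> M * norm x" for x
    using fle[of x] fle[of "- x"] linear_neg[OF f(1), of x] by simp
  have bl: "bounded_linear f"
    using f(1) fbd by (intro bounded_linear_intro[where K = M])
      (auto simp: linear_add linear_cmul mult.commute)
  show thesis
  proof (rule that[of "Blinfun f"])
    show "norm (Blinfun f) \<le> M"
      using fbd M by (intro norm_blinfun_bound) (auto simp: bounded_linear_Blinfun_apply[OF bl])
    show "b \<le> Blinfun f y" if "(y, b) \<in> D" for y b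
      using q(3)[OF that] le_funD[OF f(2), of "- y"] linear_neg[OF f(1), of y]
      by (simp add: bounded_linear_Blinfun_apply[OF bl])
  qed
qed

corollary norming_functional:
  fixes x :: "'a::real_normed_vector"
  obtains f :: "'a \<Rightarrow>\<^sub>L real" where "norm f \<le> 1" "f x = norm x"
proof -
  define D where "D = {z. \<exists>t\<ge>0. z = (t *\<^sub>R x, t * norm x)}"
  have "convex_cone D" unfolding D_def by (rule convex_cone_ray)
  moreover have "b \<le> 1 * norm y" if "(y, b) \<in> D" for y b
    using that by (auto simp: D_def)
  ultimately obtain f :: "'a \<Rightarrow>\<^sub>L real" where f: "norm f \<le> 1" "\<And>y b. (y, b) \<in> D \<Longrightarrow> b \<le> f y"
    using functional_above_cone[of D 1] by (metis zero_le_one)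
  have "norm x \<le> f x" by (intro f(2)) (auto simp: D_def intro!: exI[of _ 1])
  moreover have "f x \<le> norm x"
    using norm_blinfun[of f x] mult_right_mono[OF f(1) norm_ge_zero[of x]] by simp
  ultimately show thesis using that f(1) by force
qed

text \<open>
  Helly's condition: prescribed lower bounds on the vectors \<open>x i\<close> are attainable by a functional of norm at most
  \<open>M\<close> exactly when linear combinations respect them. The cone \<open>C\<close> of scalars is the whole line for
  prescribed values and the half-line for convex separation.
\<close>

theorem functional_above_combinations:
  fixes x :: "'i \<Rightarrow> 'a::real_normed_vector" and c :: "'i \<Rightarrow> real"
  assumes C: "convex_cone C" and M: "0 \<le> M"
    and le: "\<And>A a. finite A \<Longrightarrow> A \<subseteq> N \<Longrightarrow> (\<forall>i\<in>A. a i \<in> C) \<Longrightarrow>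
      (\<Sum>i\<in>A. a i * c i) \<le> M * norm (\<Sum>i\<in>A. a i *\<^sub>R x i)"
  shows "\<exists>f :: 'a \<Rightarrow>\<^sub>L real. norm f \<le> M \<and>
    (\<forall>i\<in>N. \<forall>t\<in>C. t * c i \<le> t * blinfun_apply f (x i))"
proof -
  define comb where "comb A a = (\<Sum>i\<in>A. a i *\<^sub>R (x i, c i))" for A and a :: "'i \<Rightarrow> real"
  define D where "D = {comb A a | A a. finite A \<and> A \<subseteq> N \<and> (\<forall>i\<in>A. a i \<in> C)}"
  have C0: "0 \<in> C" and Cadd: "\<And>s t. s \<in> C \<Longrightarrow> t \<in> C \<Longrightarrow> s + t \<in> C"
    and Csc: "\<And>s t. s \<in> C \<Longrightarrow> 0 \<le> t \<Longrightarrow> t * s \<in> C"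
    using C by (auto simp: convex_cone_iff)
  have comb: "comb A a = (\<Sum>i\<in>A. a i *\<^sub>R x i, \<Sum>i\<in>A. a i * c i)" for A a
    by (simp add: comb_def scaleR_prod_def sum_prod)
  have D: "convex_cone D"
    unfolding convex_cone_iff
  proof (intro conjI ballI allI impI)
    show "0 \<in> D" by (auto simp: D_def comb_def intro!: exI[of _ "{}"])
  next
    fix z z' assume "z \<in> D" "z' \<in> D"
    then obtain A a B b where A: "finite A" "A \<subseteq> N" "\<forall>i\<in>A. a i \<in> C" "z = comb A a"
      and B: "finite B" "B \<subseteq> N" "\<forall>i\<in>B. b i \<in> C" "z' = comb B b"
      by (auto simp: D_def)
    define d where "d i = (if i \<in> A then a i else 0) + (if i \<in> B then b i else 0)" for i
    have "comb A a = (\<Sum>i\<in>A \<union> B. (if i \<in> A then a i else 0) *\<^sub>R (x i, c i))"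
      unfolding comb_def using A B by (intro sum.mono_neutral_cong_left) (auto simp: zero_prod_def)
    moreover have "comb B b = (\<Sum>i\<in>A \<union> B. (if i \<in> B then b i else 0) *\<^sub>R (x i, c i))"
      unfolding comb_def using A B by (intro sum.mono_neutral_cong_left) (auto simp: zero_prod_def)
    ultimately have "z + z' = comb (A \<union> B) d"
      by (simp only: A B comb_def d_def scaleR_add_left sum.distrib)
    moreover have "\<forall>i\<in>A \<union> B. d i \<in> C" using A B C0 Cadd by (auto simp: d_def)
    ultimately show "z + z' \<in> D"
      unfolding D_def using A B by blast
  next
    fix z and t :: real assume "z \<in> D" "0 \<le> t"
    then obtain A a where A: "finite A" "A \<subseteq> N" "\<forall>i\<in>A. a i \<in> C" "z = comb A a"
      by (auto simp: D_def)
    have "t *\<^sub>R z = comb A (\<lambda>i. t * a i)"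
      by (simp add: A comb_def scaleR_sum_right del: scaleR_Pair)
    then show "t *\<^sub>R z \<in> D"
      unfolding D_def using A Csc \<open>0 \<le> t\<close> by (intro CollectI exI[of _ A] exI[of _ "\<lambda>i. t * a i"]) auto
  qed
  have "b \<le> M * norm y" if "(y, b) \<in> D" for y b
    using that le by (auto simp: D_def comb)
  then obtain f :: "'a \<Rightarrow>\<^sub>L real" where f: "norm f \<le> M" "\<And>y b. (y, b) \<in> D \<Longrightarrow> b \<le> f y"
    using functional_above_cone[OF D M] by metis
  show ?thesis
  proof (intro exI[of _ f] conjI ballI f(1))
    fix i t assume "i \<in> N" "t \<in> C"
    then have "comb {i} (\<lambda>_. t) \<in> D" unfolding D_def by blast
    then have "(t *\<^sub>R x i, t * c i) \<in> D" by (simp add: comb)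
    then show "t * c i \<le> t * f (x i)" using f(2) by (fastforce simp: blinfun.scaleR_right)
  qed
qed

section \<open>Normalized weakly null sequences with almost monotone initial sums\<close>

text \<open>
  Each functional lowers the dimension by at most one.
\<close>

lemma common_kernel_unit_vector:
  fixes \<Phi> :: "('a::real_normed_vector \<Rightarrow>\<^sub>L real) set"
  assumes inf: "infinite_dimensional TYPE('a)" and "finite \<Phi>"
  obtains v where "norm v = 1" "\<And>\<phi>. \<phi> \<in> \<Phi> \<Longrightarrow> \<phi> v = 0"
proof -
  have "\<not> (\<exists>B. finite B \<and> {v. \<forall>\<phi>\<in>\<Phi>. \<phi> v = 0} \<subseteq> span B)"
    using \<open>finite \<Phi>\<close>
  proof induction
    case empty
    then show ?case using inf by (auto simp: infinite_dimensional_def)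
  next
    case (insert \<psi> \<Phi>)
    show ?case
    proof
      assume "\<exists>B. finite B \<and> {v. \<forall>\<phi>\<in>insert \<psi> \<Phi>. \<phi> v = 0} \<subseteq> span B"
      then obtain B where B: "finite B" "{v. \<forall>\<phi>\<in>insert \<psi> \<Phi>. \<phi> v = 0} \<subseteq> span B" by blast
      have "\<exists>v. (\<forall>\<phi>\<in>\<Phi>. \<phi> v = 0) \<and> \<psi> v \<noteq> 0"
      proof (rule ccontr)
        assume "\<not> ?thesis"
        then have "{v. \<forall>\<phi>\<in>\<Phi>. \<phi> v = 0} \<subseteq> span B" using B(2) by auto
        then show False using insert.IH B(1) by blast
      qed
      then obtain v where v: "\<forall>\<phi>\<in>\<Phi>. \<phi> v = 0" "\<psi> v \<noteq> 0" by blast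
      have "{v. \<forall>\<phi>\<in>\<Phi>. \<phi> v = 0} \<subseteq> span (insert v B)"
      proof
        fix u assume u: "u \<in> {v. \<forall>\<phi>\<in>\<Phi>. \<phi> v = 0}"
        have "u - (\<psi> u / \<psi> v) *\<^sub>R v \<in> span B"
          using u v by (intro subsetD[OF B(2)]) (auto simp: blinfun.diff_right blinfun.scaleR_right)
        then show "u \<in> span (insert v B)" by (auto simp: span_insert)
      qed
      then show False using insert.IH B(1) by blast
    qed
  qed
  then have "\<not> {v. \<forall>\<phi>\<in>\<Phi>. \<phi> v = 0} \<subseteq> span {}" by blast
  then obtain v where v: "\<forall>\<phi>\<in>\<Phi>. \<phi> v = 0" "v \<noteq> 0" by auto
  show thesis
    by (rule that[of "v /\<^sub>R norm v"]) (use v in \<open>auto simp: blinfun.scaleR_right\<close>)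
qed

lemma compact_superset_of_bounded_combinations:
  fixes x :: "nat \<Rightarrow> 'a::real_normed_vector"
  shows "\<exists>K. compact K \<and> (\<forall>a. (\<forall>i<n. \<bar>a i\<bar> \<le> G) \<longrightarrow> (\<Sum>i<n. a i *\<^sub>R x i) \<in> K)"
proof (induction n)
  case 0
  show ?case by (rule exI[of _ "{0}"]) simp
next
  case (Suc n)
  then obtain K where K: "compact K" "\<And>a. (\<forall>i<n. \<bar>a i\<bar> \<le> G) \<Longrightarrow> (\<Sum>i<n. a i *\<^sub>R x i) \<in> K"
    by blast
  have "compact ((\<lambda>t. t *\<^sub>R x n) ` {-G..G})"
    by (intro compact_continuous_image continuous_intros) auto
  then have "compact {u + v | u v. u \<in> K \<and> v \<in> (\<lambda>t. t *\<^sub>R x n) ` {-G..G}}"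
    by (rule compact_sums[OF K(1)])
  moreover have "(\<Sum>i<Suc n. a i *\<^sub>R x i) \<in> {u + v | u v. u \<in> K \<and> v \<in> (\<lambda>t. t *\<^sub>R x n) ` {-G..G}}"
    if "\<forall>i<Suc n. \<bar>a i\<bar> \<le> G" for a
  proof -
    have "(\<Sum>i<n. a i *\<^sub>R x i) \<in> K" "a n *\<^sub>R x n \<in> (\<lambda>t. t *\<^sub>R x n) ` {-G..G}"
      using K(2)[of a] that by (simp, intro imageI) (use that[rule_format, of n] in auto)
    then show ?thesis unfolding sum.lessThan_Suc by blast
  qed
  ultimately show ?case by blast
qed

text \<open>
  The unit sphere of the span of finitely many vectors is compact once their coefficients are controlled
  by the norm; the norming functionals of a finite net of it suffice up to the factor \<open>\<theta>\<close>.
\<close>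

lemma finite_norming_set:
  fixes x :: "nat \<Rightarrow> 'a::real_normed_vector"
  assumes G: "\<And>a k. k < n \<Longrightarrow> \<bar>a k\<bar> \<le> G * norm (\<Sum>i<n. a i *\<^sub>R x i)"
    and \<theta>: "\<theta> < 1"
  shows "\<exists>\<Phi> :: ('a \<Rightarrow>\<^sub>L real) set. finite \<Phi> \<and> (\<forall>\<phi>\<in>\<Phi>. norm \<phi> \<le> 1) \<and>
    (\<forall>a. \<exists>\<phi>\<in>\<Phi>. \<theta> * norm (\<Sum>i<n. a i *\<^sub>R x i) \<le> blinfun_apply \<phi> (\<Sum>i<n. a i *\<^sub>R x i))"
proof -
  obtain K where K: "compact K" "\<And>a. (\<forall>i<n. \<bar>a i\<bar> \<le> G) \<Longrightarrow> (\<Sum>i<n. a i *\<^sub>R x i) \<in> K"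
    using compact_superset_of_bounded_combinations[of n G x] by blast
  define e where "e = (1 - \<theta>) / 2"
  have "0 < e" using \<theta> by (simp add: e_def)
  with K(1) have "\<exists>Z. finite Z \<and> K \<subseteq> (\<Union>z\<in>Z. ball z e)"
    unfolding compact_eq_totally_bounded by simp
  then obtain Z where Z: "finite Z" "K \<subseteq> (\<Union>z\<in>Z. ball z e)" by blast
  have "\<forall>z :: 'a. \<exists>f :: 'a \<Rightarrow>\<^sub>L real. norm f \<le> 1 \<and> blinfun_apply f z = norm z"
    using norming_functional by blast
  from choice[OF this] obtain \<phi> :: "'a \<Rightarrow> 'a \<Rightarrow>\<^sub>L real"
    where *: "\<forall>z. norm (\<phi> z) \<le> 1 \<and> blinfun_apply (\<phi> z) z = norm z" ..
  have \<phi>: "norm (\<phi> z) \<le> 1" "\<phi> z z = norm z" for z using spec[OF *, of z] by simp_all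
  show ?thesis
  proof (intro exI[of _ "insert 0 (\<phi> ` Z)"] conjI ballI allI)
    fix a
    define u where "u = (\<Sum>i<n. a i *\<^sub>R x i)"
    show "\<exists>f\<in>insert 0 (\<phi> ` Z). \<theta> * norm (\<Sum>i<n. a i *\<^sub>R x i) \<le> f (\<Sum>i<n. a i *\<^sub>R x i)"
    proof (cases "u = 0")
      case False
      then have nu: "0 < norm u" by simp
      have "(\<Sum>i<n. (a i / norm u) *\<^sub>R x i) = (\<Sum>i<n. inverse (norm u) *\<^sub>R (a i *\<^sub>R x i))"
        by (intro sum.cong) (simp_all add: divide_inverse mult.commute)
      then have eq: "u /\<^sub>R norm u = (\<Sum>i<n. (a i / norm u) *\<^sub>R x i)"
        by (simp only: u_def scaleR_sum_right)
      have "\<bar>a i / norm u\<bar> \<le> G" if "i < n" for i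
      proof -
        have "\<bar>a i\<bar> \<le> G * norm u" unfolding u_def by (rule G[OF that])
        then show ?thesis using nu by (simp add: pos_divide_le_eq)
      qed
      then have "u /\<^sub>R norm u \<in> K" using K(2) by (simp add: eq)
      then obtain z where z: "z \<in> Z" "norm (z - u /\<^sub>R norm u) < e"
        using Z(2) by (auto simp: dist_norm)
      have "norm (\<phi> z (z - u /\<^sub>R norm u)) \<le> norm (\<phi> z) * norm (z - u /\<^sub>R norm u)"
        by (rule norm_blinfun)
      also have "\<dots> \<le> 1 * norm (z - u /\<^sub>R norm u)"
        by (rule mult_right_mono) (use \<phi> in auto)
      also have "\<dots> < e" using z(2) by simp
      finally have "norm z - e \<le> \<phi> z (u /\<^sub>R norm u)"
        by (simp add: blinfun.diff_right \<phi>)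
      moreover have "1 - e \<le> norm z"
        using z(2) norm_triangle_ineq2[of "u /\<^sub>R norm u" z] nu
        by (simp add: norm_minus_commute[of z])
      ultimately have "\<theta> \<le> \<phi> z (u /\<^sub>R norm u)" by (simp add: e_def field_simps)
      also have "\<dots> = \<phi> z u / norm u" by (simp add: blinfun.scaleR_right divide_inverse mult.commute)
      finally have "\<theta> * norm u \<le> \<phi> z u" using nu by (simp add: field_simps)
      then show ?thesis using z(1) by (intro bexI[of _ "\<phi> z"]) (simp_all add: u_def)
    qed (auto simp: u_def)
  next
    show "finite (insert 0 (\<phi> ` Z))" using Z(1) by simp
    show "norm f \<le> 1" if "f \<in> insert 0 (\<phi> ` Z)" for f
      using that \<phi>(1) by auto
  qed
qed

text \<open>
  Mazur's construction: a vector in the common kernel of a norming set cannot shorten by more than the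
  factor \<open>\<theta>\<close> the vectors that the set norms up to this factor.
\<close>

lemma next_basic_vector:
  fixes x :: "nat \<Rightarrow> 'a::real_normed_vector" and \<Psi> :: "('a \<Rightarrow>\<^sub>L real) set"
  assumes inf: "infinite_dimensional TYPE('a)"
    and G: "\<And>a k. k < n \<Longrightarrow> \<bar>a k\<bar> \<le> G * norm (\<Sum>i<n. a i *\<^sub>R x i)"
    and \<theta>: "\<theta> < 1" and \<Psi>: "finite \<Psi>"
  shows "\<exists>v. norm v = 1 \<and> (\<forall>\<psi>\<in>\<Psi>. blinfun_apply \<psi> v = 0) \<and>
    (\<forall>a c. \<theta> * norm (\<Sum>i<n. a i *\<^sub>R x i) \<le> norm ((\<Sum>i<n. a i *\<^sub>R x i) + c *\<^sub>R v))"
proof -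
  obtain \<Phi> :: "('a \<Rightarrow>\<^sub>L real) set" where \<Phi>: "finite \<Phi>" "\<And>\<phi>. \<phi> \<in> \<Phi> \<Longrightarrow> norm \<phi> \<le> 1"
    "\<And>a. \<exists>\<phi>\<in>\<Phi>. \<theta> * norm (\<Sum>i<n. a i *\<^sub>R x i) \<le> \<phi> (\<Sum>i<n. a i *\<^sub>R x i)"
    using finite_norming_set[of n G x \<theta>, OF G \<theta>] by auto
  obtain v where v: "norm v = 1" "\<And>\<phi>. \<phi> \<in> \<Phi> \<union> \<Psi> \<Longrightarrow> \<phi> v = 0"
    using common_kernel_unit_vector[OF inf, of "\<Phi> \<union> \<Psi>"] \<Phi>(1) \<Psi> by blast
  show ?thesis
  proof (intro exI[of _ v] conjI ballI allI v(1))
    show "\<psi> v = 0" if "\<psi> \<in> \<Psi>" for \<psi> using v(2) that by blast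
    fix a and c :: real
    let ?u = "\<Sum>i<n. a i *\<^sub>R x i"
    obtain \<phi> where \<phi>: "\<phi> \<in> \<Phi>" "\<theta> * norm ?u \<le> \<phi> ?u" using \<Phi>(3) by blast
    have "\<phi> ?u = \<phi> (?u + c *\<^sub>R v)"
      using v(2) \<phi>(1) by (simp add: blinfun.add_right blinfun.scaleR_right)
    also have "\<dots> \<le> norm \<phi> * norm (?u + c *\<^sub>R v)"
      using norm_blinfun[of \<phi> "?u + c *\<^sub>R v"] by simp
    also have "\<dots> \<le> 1 * norm (?u + c *\<^sub>R v)"
      by (rule mult_right_mono) (use \<Phi>(2) \<phi>(1) in auto)
    finally show "\<theta> * norm ?u \<le> norm (?u + c *\<^sub>R v)" using \<phi>(2) by simp
  qed
qed

text \<open>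
  The basis constants of the sequence under construction. The loss allowed at step \<open>n\<close> is written as the quotient of two
  consecutive bounds, so that the losses telescope and their product from step \<open>n\<close> on is at most
  \<open>basis_bound n\<close>, which tends to one.
\<close>

definition basis_bound :: "nat \<Rightarrow> real" where
  "basis_bound n = 1 + 1 / (real n + 1)"

lemma basis_bound_bounds: "1 < basis_bound n" "basis_bound n \<le> 2"
  and basis_bound_decreasing: "basis_bound (Suc n) < basis_bound n"
  by (auto simp: basis_bound_def field_simps)

lemma basis_bound_telescope:
  fixes x :: "nat \<Rightarrow> 'a::real_normed_vector"
  assumes step: "\<And>m a c. m < n \<Longrightarrow> basis_bound (Suc m) * norm (\<Sum>i<m. a i *\<^sub>R x i)
      \<le> basis_bound m * norm ((\<Sum>i<m. a i *\<^sub>R x i) + c *\<^sub>R x m)"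
    and "k \<le> n"
  shows "basis_bound n * norm (\<Sum>i<k. a i *\<^sub>R x i) \<le> basis_bound k * norm (\<Sum>i<n. a i *\<^sub>R x i)"
  using \<open>k \<le> n\<close> step
proof (induction n rule: dec_induct)
  case (step m)
  let ?S = "\<lambda>j. norm (\<Sum>i<j. a i *\<^sub>R x i)"
  have pos: "0 < basis_bound j" for j using basis_bound_bounds(1)[of j] by simp
  have 1: "basis_bound m * ?S k \<le> basis_bound k * ?S m"
    by (rule step.IH) (use step.prems in auto)
  have 2: "basis_bound (Suc m) * ?S m \<le> basis_bound m * ?S (Suc m)"
    using step.prems[of m a "a m"] by simp
  have "basis_bound m * (basis_bound (Suc m) * ?S k) \<le> basis_bound (Suc m) * (basis_bound k * ?S m)"
    using mult_left_mono[OF 1, of "basis_bound (Suc m)"] pos[of "Suc m"] by (simp add: mult_ac)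
  also have "\<dots> \<le> basis_bound m * (basis_bound k * ?S (Suc m))"
    using mult_left_mono[OF 2, of "basis_bound k"] pos[of k] by (simp add: mult_ac)
  finally show ?case using pos[of m] by simp
qed simp

text \<open>
  A coefficient is the norm of a difference of two initial sums, each of which has at most twice the norm of the
  whole sum.
\<close>

lemma coefficient_bound:
  fixes x :: "nat \<Rightarrow> 'a::real_normed_vector"
  assumes norm1: "\<And>m. m < n \<Longrightarrow> norm (x m) = 1"
    and step: "\<And>m a c. m < n \<Longrightarrow> basis_bound (Suc m) * norm (\<Sum>i<m. a i *\<^sub>R x i)
      \<le> basis_bound m * norm ((\<Sum>i<m. a i *\<^sub>R x i) + c *\<^sub>R x m)"
    and k: "k < n"
  shows "\<bar>a k\<bar> \<le> 4 * norm (\<Sum>i<n. a i *\<^sub>R x i)"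
proof -
  have *: "norm (\<Sum>i<j. a i *\<^sub>R x i) \<le> 2 * norm (\<Sum>i<n. a i *\<^sub>R x i)" if "j \<le> n" for j
  proof -
    have "1 * norm (\<Sum>i<j. a i *\<^sub>R x i) \<le> basis_bound n * norm (\<Sum>i<j. a i *\<^sub>R x i)"
      using basis_bound_bounds(1)[of n] by (intro mult_right_mono) auto
    also have "\<dots> \<le> basis_bound j * norm (\<Sum>i<n. a i *\<^sub>R x i)"
      by (rule basis_bound_telescope[OF step that])
    also have "\<dots> \<le> 2 * norm (\<Sum>i<n. a i *\<^sub>R x i)"
      using basis_bound_bounds(2) by (intro mult_right_mono) auto
    finally show ?thesis by simp
  qed
  have "\<bar>a k\<bar> = norm ((\<Sum>i<Suc k. a i *\<^sub>R x i) - (\<Sum>i<k. a i *\<^sub>R x i))"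
    using norm1[OF k] by simp
  also have "\<dots> \<le> norm (\<Sum>i<Suc k. a i *\<^sub>R x i) + norm (\<Sum>i<k. a i *\<^sub>R x i)"
    by (rule norm_triangle_ineq4)
  also have "\<dots> \<le> 4 * norm (\<Sum>i<n. a i *\<^sub>R x i)"
    using *[of "Suc k"] *[of k] k by simp
  finally show ?thesis .
qed

lemma basic_sequence_in_kernels:
  fixes g :: "nat \<Rightarrow> 'a::real_normed_vector \<Rightarrow>\<^sub>L real"
  assumes inf: "infinite_dimensional TYPE('a)"
  obtains x :: "nat \<Rightarrow> 'a" where "\<And>n. norm (x n) = 1" "\<And>j n. j < n \<Longrightarrow> g j (x n) = 0"
    "\<And>n a c. basis_bound (Suc n) * norm (\<Sum>i<n. a i *\<^sub>R x i)
      \<le> basis_bound n * norm ((\<Sum>i<n. a i *\<^sub>R x i) + c *\<^sub>R x n)"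
proof -
  define P where "P x n v \<longleftrightarrow> norm v = 1 \<and> (\<forall>j<n. g j v = 0) \<and>
    (\<forall>a c. basis_bound (Suc n) * norm (\<Sum>i<n. a i *\<^sub>R x i)
      \<le> basis_bound n * norm ((\<Sum>i<n. a i *\<^sub>R x i) + c *\<^sub>R v))" for x :: "nat \<Rightarrow> 'a" and n v
  have "\<exists>x. \<forall>n. P x n (x n)"
  proof (rule dependent_wellorder_choice)
    fix r n and x y :: "nat \<Rightarrow> 'a" assume "\<And>m. m < n \<Longrightarrow> x m = y m"
    then have "(\<Sum>i<n. a i *\<^sub>R x i) = (\<Sum>i<n. a i *\<^sub>R y i)" for a by simp
    then show "P x n r = P y n r" by (simp add: P_def)
  next
    fix n and x :: "nat \<Rightarrow> 'a" assume P: "\<And>m. m < n \<Longrightarrow> P x m (x m)"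
    have pos: "0 < basis_bound n" using basis_bound_bounds(1)[of n] by simp
    have "basis_bound (Suc n) / basis_bound n < 1"
      using basis_bound_decreasing[of n] pos by simp
    moreover have "\<bar>a k\<bar> \<le> 4 * norm (\<Sum>i<n. a i *\<^sub>R x i)" if "k < n" for a k
      by (rule coefficient_bound[OF _ _ that]) (use P in \<open>simp_all add: P_def\<close>)
    ultimately have "\<exists>v. norm v = 1 \<and> (\<forall>\<psi>\<in>g ` {..<n}. blinfun_apply \<psi> v = 0) \<and>
        (\<forall>a c. basis_bound (Suc n) / basis_bound n * norm (\<Sum>i<n. a i *\<^sub>R x i)
          \<le> norm ((\<Sum>i<n. a i *\<^sub>R x i) + c *\<^sub>R v))"
      by (intro next_basic_vector[OF inf]) auto
    then obtain v where v: "norm v = 1" "\<forall>j<n. g j v = 0"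
      "\<And>a c. basis_bound (Suc n) / basis_bound n * norm (\<Sum>i<n. a i *\<^sub>R x i)
        \<le> norm ((\<Sum>i<n. a i *\<^sub>R x i) + c *\<^sub>R v)"
      by blast
    have "P x n v"
      unfolding P_def using v pos by (simp add: divide_simps mult_ac)
    then show "\<exists>v. P x n v" ..
  qed
  then obtain x where "\<forall>n. P x n (x n)" ..
  then show thesis using that[of x] by (simp add: P_def)
qed

lemma dense_sequence_in_dual:
  assumes "separable_space (euclidean :: ('a::real_normed_vector \<Rightarrow>\<^sub>L real) topology)"
  obtains g :: "nat \<Rightarrow> 'a::real_normed_vector \<Rightarrow>\<^sub>L real" where "\<And>f e. 0 < e \<Longrightarrow> \<exists>j. dist (g j) f < e"
proof -
  obtain C :: "('a \<Rightarrow>\<^sub>L real) set" where C: "countable C" "closure C = UNIV"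
    using assms by (auto simp: separable_space_def)
  have "C \<noteq> {}" using C(2) by auto
  then have rg: "range (from_nat_into C) = C" using C(1) by (rule range_from_nat_into)
  show thesis
  proof (rule that[of "from_nat_into C"])
    fix f and e :: real assume "0 < e"
    then have "\<exists>y\<in>C. dist y f < e" using C(2) closure_approachable[of f C] by simp
    then show "\<exists>j. dist (from_nat_into C j) f < e" using rg by (metis imageE)
  qed
qed

text \<open>
  The last condition is what Mazur's theorem gives for a weakly null sequence. It is used to average a term away: a
  bound that holds for all choices of one term passes to convex combinations of the choices.
\<close>

locale basic_null_sequence =
  fixes x :: "nat \<Rightarrow> 'a::real_normed_vector"
  assumes norm_x: "norm (x n) = 1"
    and initial_segment_bound: "finite A \<Longrightarrow>
      norm (\<Sum>i\<in>A \<inter> {..<n}. a i *\<^sub>R x i) \<le> basis_bound n * norm (\<Sum>i\<in>A. a i *\<^sub>R x i)"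
    and coordinate_functional: "\<exists>f :: 'a \<Rightarrow>\<^sub>L real. norm f \<le> 4 \<and> (\<forall>i. blinfun_apply f (x i) = (if i = k then 1 else 0))"
    and small_convex_combination: "infinite N \<Longrightarrow> 0 < e \<Longrightarrow>
      \<exists>A y. finite A \<and> A \<subseteq> N \<and> y \<in> convex hull (x ` A) \<and> norm y < e"

text \<open>
  The vectors are taken in the kernels of more and more members of a dense sequence of functionals, so every
  functional is small on late vectors. If the convex combinations of a subsequence stayed away from zero, a functional
  bounded below by a positive constant on that subsequence would exist, which is impossible.
\<close>

theorem basic_null_sequence_exists:
  assumes inf: "infinite_dimensional TYPE('a::real_normed_vector)"
    and sep: "separable_space (euclidean :: ('a::real_normed_vector \<Rightarrow>\<^sub>L real) topology)"
  obtains x :: "nat \<Rightarrow> 'a::real_normed_vector" where "basic_null_sequence x"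
proof -
  obtain g :: "nat \<Rightarrow> 'a \<Rightarrow>\<^sub>L real" where g: "\<And>f e. 0 < e \<Longrightarrow> \<exists>j. dist (g j) f < e"
    using dense_sequence_in_dual[OF sep] by blast
  obtain x :: "nat \<Rightarrow> 'a" where x: "\<And>n. norm (x n) = 1" "\<And>j n. j < n \<Longrightarrow> g j (x n) = 0"
    and step: "\<And>n a c. basis_bound (Suc n) * norm (\<Sum>i<n. a i *\<^sub>R x i)
      \<le> basis_bound n * norm ((\<Sum>i<n. a i *\<^sub>R x i) + c *\<^sub>R x n)"
    by (rule basic_sequence_in_kernels[OF inf, of g]) (rule that; assumption)
  have as_initial: "\<exists>n0. \<forall>n\<ge>n0. (\<Sum>i\<in>A. a i *\<^sub>R x i) = (\<Sum>i<n. (if i \<in> A then a i else 0) *\<^sub>R x i)"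
    if A: "finite A" for A and a :: "nat \<Rightarrow> real"
  proof -
    obtain n0 where n0: "A \<subseteq> {..<n0}" using A finite_nat_iff_bounded by blast
    have "(\<Sum>i\<in>A. a i *\<^sub>R x i) = (\<Sum>i<n. (if i \<in> A then a i else 0) *\<^sub>R x i)" if "n0 \<le> n" for n
      by (rule sum.mono_neutral_cong_left) (use n0 that in auto)
    then show ?thesis by blast
  qed
  show thesis
  proof (rule that, unfold_locales)
    show "norm (x n) = 1" for n by (rule x(1))
  next
    fix A :: "nat set" and a :: "nat \<Rightarrow> real" and n
    assume A: "finite A"
    define b where "b i = (if i \<in> A then a i else 0)" for i
    obtain n0 where n0: "\<And>m. n0 \<le> m \<Longrightarrow> (\<Sum>i\<in>A. a i *\<^sub>R x i) = (\<Sum>i<m. b i *\<^sub>R x i)"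
      using as_initial[OF A, of a] by (auto simp: b_def)
    define m where "m = max n0 n"
    have "basis_bound m * norm (\<Sum>i<n. b i *\<^sub>R x i) \<le> basis_bound n * norm (\<Sum>i<m. b i *\<^sub>R x i)"
      by (rule basis_bound_telescope[OF step]) (simp add: m_def)
    moreover have "(\<Sum>i<n. b i *\<^sub>R x i) = (\<Sum>i\<in>A \<inter> {..<n}. a i *\<^sub>R x i)"
      by (rule sum.mono_neutral_cong_right) (auto simp: b_def)
    moreover have "(\<Sum>i<m. b i *\<^sub>R x i) = (\<Sum>i\<in>A. a i *\<^sub>R x i)"
      by (rule n0[symmetric]) (simp add: m_def)
    moreover have "1 * norm (\<Sum>i<n. b i *\<^sub>R x i) \<le> basis_bound m * norm (\<Sum>i<n. b i *\<^sub>R x i)"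
      using basis_bound_bounds(1)[of m] by (intro mult_right_mono) auto
    ultimately show "norm (\<Sum>i\<in>A \<inter> {..<n}. a i *\<^sub>R x i) \<le> basis_bound n * norm (\<Sum>i\<in>A. a i *\<^sub>R x i)"
      by simp
  next
    fix k
    have "(\<Sum>i\<in>A. a i * (if i = k then 1 else 0)) \<le> 4 * norm (\<Sum>i\<in>A. a i *\<^sub>R x i)"
      if A: "finite A" for A and a :: "nat \<Rightarrow> real"
    proof -
      define b where "b i = (if i \<in> A then a i else 0)" for i
      obtain n0 where n0: "\<And>m. n0 \<le> m \<Longrightarrow> (\<Sum>i\<in>A. a i *\<^sub>R x i) = (\<Sum>i<m. b i *\<^sub>R x i)"
        using as_initial[OF A, of a] by (auto simp: b_def)
      define m where "m = max n0 (Suc k)"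
      have "\<bar>b k\<bar> \<le> 4 * norm (\<Sum>i<m. b i *\<^sub>R x i)"
        by (rule coefficient_bound[OF x(1) step]) (simp add: m_def)
      moreover have "(\<Sum>i\<in>A. a i * (if i = k then 1 else 0)) = b k"
        using A by (simp add: b_def if_distrib cong: if_cong)
      moreover have "(\<Sum>i<m. b i *\<^sub>R x i) = (\<Sum>i\<in>A. a i *\<^sub>R x i)"
        by (rule n0[symmetric]) (simp add: m_def)
      ultimately show ?thesis by simp
    qed
    then have "\<exists>f :: 'a \<Rightarrow>\<^sub>L real. norm f \<le> 4 \<and>
        (\<forall>i\<in>UNIV. \<forall>t\<in>UNIV. t * (if i = k then 1 else 0) \<le> t * blinfun_apply f (x i))"
      by (intro functional_above_combinations) (auto simp: convex_cone_iff)
    then obtain f :: "'a \<Rightarrow>\<^sub>L real" where f: "norm f \<le> 4"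
      "\<And>i t. t * (if i = k then 1 else 0) \<le> t * f (x i)" by blast
    have "f (x i) = (if i = k then 1 else 0)" for i
      using f(2)[of 1 i] f(2)[of "-1" i] by (auto split: if_splits)
    with f(1) show "\<exists>f :: 'a \<Rightarrow>\<^sub>L real. norm f \<le> 4 \<and> (\<forall>i. blinfun_apply f (x i) = (if i = k then 1 else 0))"
      by blast
  next
    fix N :: "nat set" and e :: real assume N: "infinite N" and e: "0 < e"
    show "\<exists>A y. finite A \<and> A \<subseteq> N \<and> y \<in> convex hull (x ` A) \<and> norm y < e"
    proof (rule ccontr)
      assume none: "\<not> ?thesis"
      have "(\<Sum>i\<in>A. a i * e) \<le> 1 * norm (\<Sum>i\<in>A. a i *\<^sub>R x i)"
        if A: "finite A" "A \<subseteq> N" and a: "\<forall>i\<in>A. a i \<in> {0..}" for A a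
      proof (cases "sum a A = 0")
        case True
        then show ?thesis by (simp flip: sum_distrib_right)
      next
        case False
        define s where "s = sum a A"
        have s: "0 < s" using False a sum_nonneg[of A a] by (auto simp: s_def less_le)
        have "(\<Sum>i\<in>A. (a i / s) *\<^sub>R x i) \<in> convex hull (x ` A)"
        proof (rule convex_sum[OF A(1) convex_convex_hull])
          show "(\<Sum>i\<in>A. a i / s) = 1"
            using s by (simp add: s_def flip: sum_divide_distrib)
          show "0 \<le> a i / s" if "i \<in> A" for i using a s that by simp
          show "x i \<in> convex hull (x ` A)" if "i \<in> A" for i using that by (intro hull_inc) simp
        qed
        then have "\<not> norm (\<Sum>i\<in>A. (a i / s) *\<^sub>R x i) < e"
          using none A by blast
        moreover have "(\<Sum>i\<in>A. (a i / s) *\<^sub>R x i) = (1 / s) *\<^sub>R (\<Sum>i\<in>A. a i *\<^sub>R x i)"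
          by (simp add: scaleR_sum_right)
        ultimately have "e \<le> norm (\<Sum>i\<in>A. a i *\<^sub>R x i) / s" using s by simp
        then have "s * e \<le> norm (\<Sum>i\<in>A. a i *\<^sub>R x i)" using s by (simp add: field_simps)
        then show ?thesis by (simp add: s_def sum_distrib_right)
      qed
      then have "\<exists>f :: 'a \<Rightarrow>\<^sub>L real. norm f \<le> 1 \<and>
          (\<forall>i\<in>N. \<forall>t\<in>{0..}. t * e \<le> t * blinfun_apply f (x i))"
        by (intro functional_above_combinations) (auto simp: convex_cone_iff)
      then obtain f :: "'a \<Rightarrow>\<^sub>L real" where f: "\<forall>i\<in>N. \<forall>t\<in>{0..}. t * e \<le> t * f (x i)"
        by blast
      obtain j where j: "dist (g j) f < e" using g[OF e] by blast
      obtain n where n: "n \<in> N" "j < n" using N by (meson infinite_nat_iff_unbounded)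
      have "e \<le> f (x n)" using f[rule_format, OF n(1), of 1] by simp
      also have "\<dots> = (f - g j) (x n)" using x(2)[OF n(2)] by (simp add: blinfun.diff_left)
      also have "\<dots> \<le> norm (f - g j) * norm (x n)" using norm_blinfun[of "f - g j" "x n"] by simp
      also have "\<dots> < e" using j by (simp add: x(1) dist_norm norm_minus_commute)
      finally show False by simp
    qed
  qed
qed

section \<open>Infinite Ramsey theory for sets of naturals\<close>

lemma infinite_tail:
  assumes "infinite N" "finite s"
  shows "infinite {m\<in>N. \<forall>k\<in>s. k < (m::nat)}"
proof -
  have "{m\<in>N. \<not> (\<forall>k\<in>s. k < m)} \<subseteq> (\<Union>k\<in>s. {..k})" by (auto simp: not_less)
  then have "finite {m\<in>N. \<not> (\<forall>k\<in>s. k < m)}"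
    by (rule finite_subset) (use assms(2) in simp)
  moreover have "{m\<in>N. \<forall>k\<in>s. k < m} = N - {m\<in>N. \<not> (\<forall>k\<in>s. k < m)}" by blast
  ultimately show ?thesis using assms(1) by simp
qed

text \<open>
  Ramsey's theorem in the form in which it is applied: the homogeneous colour is \<open>P\<close>, since the other colour
  contradicts density.
\<close>

lemma ramsey_of_dense_property:
  fixes N :: "nat set"
  assumes "infinite N"
    and dense: "\<And>M. M \<subseteq> N \<Longrightarrow> infinite M \<Longrightarrow> \<exists>X\<subseteq>M. finite X \<and> card X = k \<and> P X"
  shows "\<exists>M\<subseteq>N. infinite M \<and> (\<forall>X. X \<subseteq> M \<and> finite X \<and> card X = k \<longrightarrow> P X)"
proof -
  have "\<forall>X. X \<subseteq> N \<and> finite X \<and> card X = k \<longrightarrow> (if P X then 0 else 1) < (2::nat)" by simp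
  from Ramsey[OF assms(1) this]
  obtain M and t :: nat where M: "M \<subseteq> N" "infinite M"
    and t: "\<forall>X. X \<subseteq> M \<and> finite X \<and> card X = k \<longrightarrow> (if P X then 0 else 1) = t"
    by auto
  obtain X where "X \<subseteq> M" "finite X" "card X = k" "P X" using dense[OF M] by blast
  then have "t = 0" using t by auto
  then have "\<forall>X. X \<subseteq> M \<and> finite X \<and> card X = k \<longrightarrow> P X"
    using t by (metis zero_neq_one)
  with M show ?thesis by blast
qed

lemma ramsey_pairs_dichotomy:
  fixes N :: "nat set"
  assumes "infinite N"
  shows "\<exists>M\<subseteq>N. infinite M \<and>
    ((\<forall>i\<in>M. \<forall>j\<in>M. i < j \<longrightarrow> P i j) \<or> (\<forall>i\<in>M. \<forall>j\<in>M. i < j \<longrightarrow> \<not> P i j))"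
proof -
  define c :: "nat set \<Rightarrow> nat" where "c X = (if P (Min X) (Max X) then 0 else 1)" for X
  have c: "c {i, j} = (if P i j then 0 else 1)" if "i < j" for i j
    using that by (simp add: c_def min_def max_def)
  have "\<forall>i\<in>N. \<forall>j\<in>N. i \<noteq> j \<longrightarrow> c {i, j} < 2" by (simp add: c_def)
  from Ramsey2[OF assms this]
  obtain M t where M: "M \<subseteq> N" "infinite M" and t: "\<forall>i\<in>M. \<forall>j\<in>M. i \<noteq> j \<longrightarrow> c {i, j} = t" by auto
  have "P i j \<longleftrightarrow> t = 0" if "i \<in> M" "j \<in> M" "i < j" for i j
    using t[rule_format, OF that(1,2)] c[OF that(3)] that(3) by (auto split: if_splits)
  with M show ?thesis by (cases "t = 0") blast+
qed

text \<open>
  Diagonalization: if a hereditary requirement on the future of each finite set can be met by shrinking, all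
  finite subsets of one infinite set can have their requirements met at once. The members of \<open>M\<close> are the least elements of a
  decreasing sequence of sets, each of which meets the requirements of all subsets of \<open>{..m}\<close>, where \<open>m\<close> is the least
  element of its predecessor.
\<close>

lemma fusion:
  fixes N :: "nat set"
  assumes "infinite N"
    and step: "\<And>s A. finite s \<Longrightarrow> infinite A \<Longrightarrow> A \<subseteq> N \<Longrightarrow> \<exists>B\<subseteq>A. infinite B \<and> Q s B"
    and her: "\<And>s A B. Q s A \<Longrightarrow> B \<subseteq> A \<Longrightarrow> infinite B \<Longrightarrow> Q s B"
  obtains M where "M \<subseteq> N" "infinite M"
    "\<And>s. finite s \<Longrightarrow> s \<subseteq> M \<Longrightarrow> Q s {m\<in>M. \<forall>k\<in>s. k < m}"
proof -
  have fin_step: "\<exists>B\<subseteq>A. infinite B \<and> (\<forall>s\<in>S. Q s B)"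
    if "finite S" "\<forall>s\<in>S. finite s" "infinite A" "A \<subseteq> N" for S A
    using that
  proof (induction S)
    case (insert s S)
    then obtain B where B: "B \<subseteq> A" "infinite B" "\<forall>s\<in>S. Q s B" by auto
    moreover obtain B' where "B' \<subseteq> B" "infinite B'" "Q s B'"
      using step[of s B] B insert.prems by auto
    ultimately show ?case using her by (intro exI[of _ B']) blast
  qed auto
  let ?m = "\<lambda>B :: nat set. LEAST m. m \<in> B"
  have "\<exists>B. \<forall>i. (infinite (B i) \<and> B i \<subseteq> N \<and> (i = 0 \<longrightarrow> Q {} (B i))) \<and>
      (B (Suc i) \<subseteq> {b\<in>B i. ?m (B i) < b} \<and> (\<forall>s\<subseteq>{..?m (B i)}. Q s (B (Suc i))))"
  proof (rule dependent_nat_choice)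
    show "\<exists>B. infinite B \<and> B \<subseteq> N \<and> (0 = (0::nat) \<longrightarrow> Q {} B)"
      using step[of "{}" N] assms(1) by auto
  next
    fix B :: "nat set" and i :: nat
    assume B: "infinite B \<and> B \<subseteq> N \<and> (i = 0 \<longrightarrow> Q {} B)"
    have "infinite (B - {..?m B})" using B by (meson Diff_infinite_finite finite_atMost)
    moreover have "finite (Pow {..?m B})" "\<forall>s\<in>Pow {..?m B}. finite s"
      by (auto intro: finite_subset)
    ultimately obtain B' where "B' \<subseteq> B - {..?m B}" "infinite B'" "\<forall>s\<in>Pow {..?m B}. Q s B'"
      using fin_step[of "Pow {..?m B}" "B - {..?m B}"] B by blast
    then show "\<exists>B'. (infinite B' \<and> B' \<subseteq> N \<and> (Suc i = 0 \<longrightarrow> Q {} B')) \<and>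
        (B' \<subseteq> {b\<in>B. ?m B < b} \<and> (\<forall>s\<subseteq>{..?m B}. Q s B'))"
      using B by (intro exI[of _ B']) auto
  qed
  then obtain B where *: "\<forall>i. (infinite (B i) \<and> B i \<subseteq> N \<and> (i = 0 \<longrightarrow> Q {} (B i))) \<and>
      (B (Suc i) \<subseteq> {b\<in>B i. ?m (B i) < b} \<and> (\<forall>s\<subseteq>{..?m (B i)}. Q s (B (Suc i))))" ..
  have B: "\<And>i. infinite (B i)" "\<And>i. B i \<subseteq> N" "Q {} (B 0)"
      "\<And>i. B (Suc i) \<subseteq> {b\<in>B i. ?m (B i) < b}" "\<And>i s. s \<subseteq> {..?m (B i)} \<Longrightarrow> Q s (B (Suc i))"
    using * by simp_all
  define m where "m i = ?m (B i)" for i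
  have m_in: "m i \<in> B i" for i
    unfolding m_def using B(1)[of i] by (metis LeastI_ex finite.emptyI ex_in_conv)
  have m_mono: "strict_mono m"
    using m_in B(4) by (auto simp: strict_mono_Suc_iff m_def)
  have B_anti: "B j \<subseteq> B i" if "i \<le> j" for i j
    using B(4) by (intro lift_Suc_antimono_le[OF _ that]) auto
  have inf: "infinite (range m)"
    using m_mono strict_mono_imp_inj_on finite_imageD infinite_UNIV_nat by blast
  show thesis
  proof (rule that[of "range m"])
    show "range m \<subseteq> N" using m_in B(2) by blast
    show "infinite (range m)" by (rule inf)
    fix s assume s: "finite s" "s \<subseteq> range m"
    show "Q s {n\<in>range m. \<forall>k\<in>s. k < n}"
    proof (cases "s = {}")
      case True
      have "range m \<subseteq> B 0" using m_in B_anti by blast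
      then show ?thesis using her[OF B(3) _ inf] True by simp
    next
      case False
      then obtain i where i: "Max s = m i" using s Max_in by blast
      have "s \<subseteq> {..?m (B i)}" unfolding m_def[symmetric] using Max_ge[OF s(1)] i by auto
      then have Q: "Q s (B (Suc i))" by (rule B(5))
      have eq: "{n\<in>range m. \<forall>k\<in>s. k < n} = {n\<in>range m. m i < n}"
        using s False by (auto simp flip: i)
      have "{n\<in>range m. m i < n} \<subseteq> B (Suc i)"
      proof
        fix n assume "n \<in> {n\<in>range m. m i < n}"
        then obtain j where j: "n = m j" "m i < m j" by blast
        then have "Suc i \<le> j" using strict_mono_less[OF m_mono] by auto
        then show "n \<in> B (Suc i)" using m_in[of j] B_anti j(1) by blast
      qed
      moreover have "{n\<in>range m. m i < n} = range m - {..m i}" by auto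
      then have "infinite {n\<in>range m. m i < n}" using inf by simp
      ultimately show ?thesis unfolding eq using her[OF Q] by blast
    qed
  qed
qed

text \<open>
  Galvin's lemma, by combinatorial forcing. A set \<open>M\<close> accepts \<open>s\<close> if every continuation of \<open>s\<close> inside \<open>M\<close>
  has an initial segment in \<open>F\<close>, and rejects \<open>s\<close> if no infinite subset of \<open>M\<close> accepts it. By fusion all
  finite subsets of some \<open>M1\<close> are decided. If the empty set is rejected, then, because infinitely many
  accepted one-point extensions of \<open>s\<close> would make \<open>s\<close> accepted, a second fusion yields a set all of whose finite
  subsets are rejected; these cannot belong to \<open>F\<close>.
\<close>

theorem galvin:
  fixes N :: "nat set" and F :: "nat set \<Rightarrow> bool"
  assumes N: "infinite N"
  obtains M where "M \<subseteq> N" "infinite M" "\<And>t. finite t \<Longrightarrow> t \<subseteq> M \<Longrightarrow> \<not> F t"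
  | M where "M \<subseteq> N" "infinite M" "\<And>L. L \<subseteq> M \<Longrightarrow> infinite L \<Longrightarrow> \<exists>n. F (L \<inter> {..<n})"
proof -
  define accept where "accept s M \<longleftrightarrow>
    (\<forall>L\<subseteq>M. infinite L \<longrightarrow> (\<forall>k\<in>s. \<forall>l\<in>L. k < l) \<longrightarrow> (\<exists>n. F ((s \<union> L) \<inter> {..<n})))" for s M
  define reject where "reject s M \<longleftrightarrow> (\<forall>B\<subseteq>M. infinite B \<longrightarrow> \<not> accept s B)" for s M
  have accept_mono: "accept s B" if "accept s A" "B \<subseteq> A" for s A B
    using that by (auto simp: accept_def)
  have reject_mono: "reject s B" if "reject s A" "B \<subseteq> A" for s A B
    using that by (auto simp: reject_def)
  have acceptD: "\<exists>n. F ((s \<union> L) \<inter> {..<n})"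
    if "accept s M" "L \<subseteq> M" "infinite L" "\<forall>k\<in>s. \<forall>l\<in>L. k < l" for s L M
    using that unfolding accept_def by blast
  have accept_tail: "accept s M" if "accept s {m\<in>M. \<forall>k\<in>s. k < m}" for s M
    unfolding accept_def
  proof (intro allI impI)
    fix L assume "L \<subseteq> M" "infinite L" "\<forall>k\<in>s. \<forall>l\<in>L. k < l"
    then show "\<exists>n. F ((s \<union> L) \<inter> {..<n})"
      using that[unfolded accept_def, rule_format, of L] by blast
  qed
  have reject_tail: "reject s M" if "reject s {m\<in>M. \<forall>k\<in>s. k < m}" "finite s" for s M
    unfolding reject_def
  proof (intro allI impI notI)
    fix B assume B: "B \<subseteq> M" "infinite B" "accept s B"
    have "accept s {b\<in>B. \<forall>k\<in>s. k < b}" using accept_mono[OF B(3)] by simp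
    moreover have "{b\<in>B. \<forall>k\<in>s. k < b} \<subseteq> {m\<in>M. \<forall>k\<in>s. k < m}" using B(1) by blast
    ultimately show False
      using that(1) infinite_tail[OF B(2) that(2)] unfolding reject_def by blast
  qed
  obtain M1 where M1: "M1 \<subseteq> N" "infinite M1"
    and decide': "\<And>s. finite s \<Longrightarrow> s \<subseteq> M1 \<Longrightarrow>
      accept s {m\<in>M1. \<forall>k\<in>s. k < m} \<or> reject s {m\<in>M1. \<forall>k\<in>s. k < m}"
  proof (rule fusion[OF N, of "\<lambda>s B. accept s B \<or> reject s B"])
    fix s A :: "nat set" assume "infinite A"
    then show "\<exists>B\<subseteq>A. infinite B \<and> (accept s B \<or> reject s B)"
      unfolding reject_def by blast
  next
    fix s A B :: "nat set" assume "accept s A \<or> reject s A" "B \<subseteq> A"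
    then show "accept s B \<or> reject s B"
      using accept_mono[of s A B] reject_mono[of s A B] by blast
  qed (rule that; assumption)
  have decide: "accept s M1 \<or> reject s M1" if "finite s" "s \<subseteq> M1" for s
    using decide'[OF that] accept_tail reject_tail that by blast
  show thesis
  proof (cases "accept {} M1")
    case True
    then show ?thesis using M1 by (intro that(2)[of M1]) (auto simp: accept_def)
  next
    case False
    obtain M2 where M2: "M2 \<subseteq> M1" "infinite M2"
      and ext: "\<And>s. finite s \<Longrightarrow> s \<subseteq> M2 \<Longrightarrow> s \<subseteq> M1 \<longrightarrow> reject s M1 \<longrightarrow>
        (\<forall>n\<in>{m\<in>M2. \<forall>k\<in>s. k < m}. (\<forall>k\<in>s. k < n) \<longrightarrow> reject (insert n s) M1)"
    proof (rule fusion[OF M1(2), of "\<lambda>s B. s \<subseteq> M1 \<longrightarrow> reject s M1 \<longrightarrow>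
        (\<forall>n\<in>B. (\<forall>k\<in>s. k < n) \<longrightarrow> reject (insert n s) M1)"])
      fix s A :: "nat set" assume s: "finite s" and A: "infinite A" "A \<subseteq> M1"
      define E where "E = {n\<in>A. (\<forall>k\<in>s. k < n) \<and> accept (insert n s) M1}"
      have fE: "finite E" if rej: "reject s M1"
      proof (rule ccontr)
        assume infE: "infinite E"
        have "accept s E"
          unfolding accept_def
        proof (intro allI impI)
          fix L assume L: "L \<subseteq> E" "infinite L" "\<forall>k\<in>s. \<forall>l\<in>L. k < l"
          define n where "n = (LEAST n. n \<in> L)"
          have n: "n \<in> L" "\<And>l. l \<in> L \<Longrightarrow> n \<le> l"
            unfolding n_def using L(2) by (metis LeastI_ex finite.emptyI ex_in_conv, metis Least_le)
          have "accept (insert n s) M1" using n(1) L(1) by (auto simp: E_def)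
          moreover have "L - {n} \<subseteq> M1" "infinite (L - {n})" using L A by (auto simp: E_def)
          moreover have "\<forall>k\<in>insert n s. \<forall>l\<in>L - {n}. k < l"
            using L(3) n(2) by (auto simp: less_le)
          ultimately have "\<exists>m. F ((insert n s \<union> (L - {n})) \<inter> {..<m})"
            by (rule acceptD)
          moreover have "insert n s \<union> (L - {n}) = s \<union> L" using n(1) by blast
          ultimately show "\<exists>m. F ((s \<union> L) \<inter> {..<m})" by simp
        qed
        moreover have "E \<subseteq> M1" using A(2) by (auto simp: E_def)
        ultimately show False using rej infE by (simp add: reject_def)
      qed
      show "\<exists>B\<subseteq>A. infinite B \<and> (s \<subseteq> M1 \<longrightarrow> reject s M1 \<longrightarrow>
          (\<forall>n\<in>B. (\<forall>k\<in>s. k < n) \<longrightarrow> reject (insert n s) M1))"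
      proof (cases "s \<subseteq> M1 \<and> reject s M1")
        case True
        then have "infinite (A - E)" using fE A by simp
        moreover have "reject (insert n s) M1" if "n \<in> A - E" "\<forall>k\<in>s. k < n" for n
        proof -
          have "\<not> accept (insert n s) M1" "insert n s \<subseteq> M1"
            using that True A(2) by (auto simp: E_def)
          then show ?thesis using decide[of "insert n s"] s by simp
        qed
        ultimately have "A - E \<subseteq> A \<and> infinite (A - E) \<and> (s \<subseteq> M1 \<longrightarrow> reject s M1 \<longrightarrow>
            (\<forall>n\<in>A - E. (\<forall>k\<in>s. k < n) \<longrightarrow> reject (insert n s) M1))"
          by auto
        then show ?thesis ..
      next
        case False
        then show ?thesis using A(1) by (intro exI[of _ A]) simp
      qed
    next
      fix s A B :: "nat set"
      assume "s \<subseteq> M1 \<longrightarrow> reject s M1 \<longrightarrow> (\<forall>n\<in>A. (\<forall>k\<in>s. k < n) \<longrightarrow> reject (insert n s) M1)"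
        and "B \<subseteq> A"
      then show "s \<subseteq> M1 \<longrightarrow> reject s M1 \<longrightarrow> (\<forall>n\<in>B. (\<forall>k\<in>s. k < n) \<longrightarrow> reject (insert n s) M1)"
        by blast
    qed (rule that; assumption)
    have rej: "reject s M1" if "finite s" "s \<subseteq> M2" for s
      using that
    proof (induction s rule: finite_linorder_max_induct)
      case empty
      then show ?case using decide[of "{}"] False by simp
    next
      case (insert b A)
      then show ?case using ext[of A] M2(1) by auto
    qed
    have "\<not> F t" if t: "finite t" "t \<subseteq> M2" for t
    proof
      assume F: "F t"
      have "accept t M1"
        unfolding accept_def
      proof (intro allI impI)
        fix L assume L: "L \<subseteq> M1" "infinite L" "\<forall>k\<in>t. \<forall>l\<in>L. k < l"
        define n where "n = (LEAST n. n \<in> L)"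
        have n: "n \<in> L" "\<And>l. l \<in> L \<Longrightarrow> n \<le> l"
          unfolding n_def using L(2) by (metis LeastI_ex finite.emptyI ex_in_conv, metis Least_le)
        have "(t \<union> L) \<inter> {..<n} = t" using n L(3) by (force simp: not_less)
        then show "\<exists>n. F ((t \<union> L) \<inter> {..<n})" using F by metis
      qed
      then show False using rej[OF t] M1(2) unfolding reject_def by blast
    qed
    with M1 M2 show ?thesis by (intro that(1)[of M2]) auto
  qed
qed

definition before :: "nat set \<Rightarrow> nat set \<Rightarrow> bool" where
  "before s t \<longleftrightarrow> (\<forall>k\<in>s. \<forall>l\<in>t. k < l)"

text \<open>
  Successive finite sets, each chosen with regard to all its predecessors. The family \<open>S\<close> stands for the
  predecessors, and \<open>L\<close> for the indices that remain.
\<close>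

lemma block_sequence:
  assumes M: "infinite M"
    and ext: "\<And>S L. finite S \<Longrightarrow> (\<forall>s\<in>S. finite s \<and> s \<noteq> {} \<and> s \<subseteq> M \<and> G s \<and> before s L) \<Longrightarrow>
      L \<subseteq> M \<Longrightarrow> infinite L \<Longrightarrow> \<exists>t. finite t \<and> t \<noteq> {} \<and> t \<subseteq> L \<and> G t \<and> (\<forall>s\<in>S. H s t)"
  shows "\<exists>r :: nat \<Rightarrow> nat set. \<forall>j. (finite (r j) \<and> r j \<noteq> {} \<and> r j \<subseteq> M \<and> G (r j)) \<and>
    (\<forall>i<j. before (r i) (r j) \<and> H (r i) (r j))"
proof -
  define P where "P r j t \<longleftrightarrow> (finite t \<and> t \<noteq> {} \<and> t \<subseteq> M \<and> G t) \<and> (\<forall>i<j. before (r i) t \<and> H (r i) t)"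
    for r :: "nat \<Rightarrow> nat set" and j t
  have "\<exists>r. \<forall>j. P r j (r j)"
  proof (rule dependent_wellorder_choice)
    show "P r j t = P r' j t" if "\<And>i. i < j \<Longrightarrow> r i = r' i" for t r r' j
      using that by (simp add: P_def)
  next
    fix r :: "nat \<Rightarrow> nat set" and j
    assume r: "\<And>i. i < j \<Longrightarrow> P r i (r i)"
    then have r': "finite (r i) \<and> r i \<noteq> {} \<and> r i \<subseteq> M \<and> G (r i)" if "i < j" for i
      using that by (simp add: P_def)
    define L where "L = {m\<in>M. \<forall>k\<in>(\<Union>i<j. r i). k < m}"
    have "infinite L" unfolding L_def by (rule infinite_tail[OF M]) (use r' in simp)
    moreover have "before (r i) L" if "i < j" for i
      using that by (auto simp: before_def L_def)
    moreover have "L \<subseteq> M" by (auto simp: L_def)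
    ultimately have "\<exists>t. finite t \<and> t \<noteq> {} \<and> t \<subseteq> L \<and> G t \<and> (\<forall>s\<in>r ` {..<j}. H s t)"
      using r' by (intro ext) simp_all
    then obtain t where t: "finite t" "t \<noteq> {}" "t \<subseteq> L" "G t" "\<forall>i<j. H (r i) t" by auto
    moreover have "\<forall>i<j. before (r i) t" using t(3) by (auto simp: before_def L_def)
    moreover have "t \<subseteq> M" using t(3) by (auto simp: L_def)
    ultimately show "\<exists>t. P r j t" unfolding P_def by blast
  qed
  then show ?thesis by (simp add: P_def)
qed

section \<open>Separated sequences are almost antipodal\<close>

text \<open>
  The functionals \<open>h\<close> separate \<open>y i\<close> and \<open>y j\<close> from the remaining
  terms with a gap of one and with uniformly bounded norms; they are added with a small weight to norming functionals of
  \<open>y i - y j\<close>, whose extremality is only approximate.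
\<close>

theorem Ka_gt_one_if_separated:
  fixes y :: "nat \<Rightarrow> 'a::real_normed_vector"
  assumes R: "0 < R" and \<delta>: "0 < \<delta>" and bound: "\<And>n. norm (y n) \<le> R"
    and sep: "\<And>i j. i < j \<Longrightarrow> R * (1 + \<delta>) \<le> norm (y i - y j)"
    and h: "\<And>i j. i < j \<Longrightarrow> \<exists>h :: 'a \<Rightarrow>\<^sub>L real. norm h \<le> G \<and>
      (\<forall>k. k \<noteq> i \<longrightarrow> blinfun_apply h (y k) + 1 \<le> blinfun_apply h (y i)) \<and>
      (\<forall>k. k \<noteq> j \<longrightarrow> blinfun_apply h (y j) + 1 \<le> blinfun_apply h (y k))"
  shows "1 < Ka TYPE('a)"
proof -
  have sep': "R * (1 + \<delta>) \<le> norm (y i - y j)" if "i \<noteq> j" for i j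
    using sep[of i j] sep[of j i] that by (cases "i < j") (auto simp: norm_minus_commute)
  have G: "0 \<le> G" using h[of 0 1] norm_ge_zero order_trans by (metis zero_less_one)
  \<comment> \<open>The weight of \<open>h\<close>, which is also the tolerance for the distances: \<open>e * G < \<delta>\<close> keeps the normalized
    gap \<open>(1 + \<delta>) / (1 + e * G)\<close> above one.\<close>
  define e where "e = \<delta> / (G + 1)"
  have e: "0 < e" using \<delta> G by (simp add: e_def)
  define q where "q = 1 + e * G"
  have "e * G < \<delta>" using \<delta> G by (simp add: e_def field_simps)
  then have q: "0 < q" "q < 1 + \<delta>" using e G by (auto simp: q_def add_pos_nonneg)
  define colour where "colour X = nat \<lfloor>norm (y (Min X) - y (Max X)) / e\<rfloor>" for X
  have colour: "colour {i, j} = nat \<lfloor>norm (y i - y j) / e\<rfloor>" if "i \<noteq> j" for i j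
    using that by (cases "i < j") (auto simp: colour_def min_def max_def norm_minus_commute)
  have "\<forall>i\<in>UNIV. \<forall>j\<in>UNIV. i \<noteq> j \<longrightarrow> colour {i, j} < Suc (nat \<lfloor>(2 * R) / e\<rfloor>)"
  proof (intro ballI impI)
    fix i j :: nat assume "i \<noteq> j"
    have "norm (y i - y j) \<le> 2 * R"
      using norm_triangle_ineq4[of "y i" "y j"] bound[of i] bound[of j] by simp
    then have "norm (y i - y j) / e \<le> (2 * R) / e" using e by (simp add: divide_right_mono)
    then show "colour {i, j} < Suc (nat \<lfloor>(2 * R) / e\<rfloor>)"
      unfolding colour[OF \<open>i \<noteq> j\<close>] less_Suc_eq_le by (intro nat_mono floor_mono)
  qed
  from Ramsey2[OF infinite_UNIV_nat this]
  obtain Y t where Y: "infinite Y" and t: "\<forall>i\<in>Y. \<forall>j\<in>Y. i \<noteq> j \<longrightarrow> colour {i, j} = t"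
    by auto
  define D where "D = e * (real t + 1)"
  have D: "D - e \<le> norm (y i - y j)" "norm (y i - y j) \<le> D" if "i \<in> Y" "j \<in> Y" "i \<noteq> j" for i j
  proof -
    have "\<lfloor>norm (y i - y j) / e\<rfloor> = int t"
      using t[rule_format, OF that] colour[OF that(3)] e by (simp add: nat_eq_iff)
    then have "real t \<le> norm (y i - y j) / e" "norm (y i - y j) / e < real t + 1"
      by linarith+
    then show "D - e \<le> norm (y i - y j)" "norm (y i - y j) \<le> D"
      using e by (auto simp: D_def field_simps)
  qed
  define good where "good f i j \<longleftrightarrow> norm f \<le> 1 \<and> R * (1 + \<delta>) / q \<le> blinfun_apply f (y i) - blinfun_apply f (y j) \<and>
    (\<forall>k\<in>Y. blinfun_apply f (y j) \<le> blinfun_apply f (y k) \<and> blinfun_apply f (y k) \<le> blinfun_apply f (y i))"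
    for f :: "'a \<Rightarrow>\<^sub>L real" and i j
  have good_less: "\<exists>f. good f i j" if ij: "i \<in> Y" "j \<in> Y" "i < j" for i j
  proof -
    obtain h :: "'a \<Rightarrow>\<^sub>L real" where h: "norm h \<le> G" "\<And>k. k \<noteq> i \<Longrightarrow> h (y k) + 1 \<le> h (y i)"
        "\<And>k. k \<noteq> j \<Longrightarrow> h (y j) + 1 \<le> h (y k)"
      using h[OF ij(3)] by blast
    obtain f :: "'a \<Rightarrow>\<^sub>L real" where f: "norm f \<le> 1" "f (y i - y j) = norm (y i - y j)"
      using norming_functional by blast
    have f_le: "f u - f v \<le> norm (u - v)" for u v
    proof -
      have "f u - f v \<le> norm f * norm (u - v)"
        using norm_blinfun[of f "u - v"] by (simp add: blinfun.diff_right)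
      also have "\<dots> \<le> 1 * norm (u - v)" by (rule mult_right_mono[OF f(1)]) simp
      finally show ?thesis by simp
    qed
    have f_ij: "f (y i) - f (y j) = norm (y i - y j)" using f(2) by (simp add: blinfun.diff_right)
    define F where "F = f + e *\<^sub>R h"
    have F: "F u = f u + e * h u" for u
      by (simp add: F_def blinfun.add_left blinfun.scaleR_left)
    have F_top: "F (y k) \<le> F (y i)" if "k \<in> Y" for k
    proof (cases "k = i \<or> k = j")
      case True
      have "h (y j) \<le> h (y i)" using h(2)[of j] ij(3) by simp
      then have "F (y j) \<le> F (y i)" using f_ij e unfolding F
        by (smt (verit) mult_left_mono norm_ge_zero)
      with True show ?thesis by auto
    next
      case False
      have "f (y k) - f (y j) \<le> D" using f_le[of "y k" "y j"] D(2)[of k j] that ij False by simp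
      moreover have "D - e \<le> f (y i) - f (y j)" using D(1)[OF ij(1,2)] ij(3) f_ij by simp
      moreover have "e * (h (y k) + 1) \<le> e * h (y i)"
        using h(2)[of k] False e by (intro mult_left_mono) auto
      ultimately show ?thesis by (simp add: F algebra_simps)
    qed
    have F_bot: "F (y j) \<le> F (y k)" if "k \<in> Y" for k
    proof (cases "k = i \<or> k = j")
      case True
      then show ?thesis using F_top[OF ij(2)] by auto
    next
      case False
      have "f (y i) - f (y k) \<le> D" using f_le[of "y i" "y k"] D(2)[of i k] that ij False by simp
      moreover have "D - e \<le> f (y i) - f (y j)" using D(1)[OF ij(1,2)] ij(3) f_ij by simp
      moreover have "e * (h (y j) + 1) \<le> e * h (y k)"
        using h(3)[of k] False e by (intro mult_left_mono) auto
      ultimately show ?thesis by (simp add: F algebra_simps)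
    qed
    have F_gap: "R * (1 + \<delta>) \<le> F (y i) - F (y j)"
    proof -
      have "e * h (y j) \<le> e * h (y i)" using h(2)[of j] ij(3) e by (intro mult_left_mono) auto
      then show ?thesis using sep[OF ij(3)] f_ij by (simp add: F)
    qed
    have F_norm: "norm F \<le> q"
    proof -
      have "norm F \<le> norm f + norm (e *\<^sub>R h)" unfolding F_def by (rule norm_triangle_ineq)
      also have "\<dots> \<le> 1 + e * G" using f(1) h(1) e by (simp add: add_mono mult_left_mono)
      finally show ?thesis by (simp add: q_def)
    qed
    have ev: "(F /\<^sub>R q) u = F u / q" for u
      by (simp add: blinfun.scaleR_left divide_inverse mult.commute)
    have "norm (F /\<^sub>R q) \<le> 1"
      using F_norm q(1) by (simp add: field_simps)
    moreover have "R * (1 + \<delta>) / q \<le> F (y i) / q - F (y j) / q"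
      using divide_right_mono[OF F_gap, of q] q(1) by (simp add: diff_divide_distrib)
    ultimately have "good (F /\<^sub>R q) i j"
      unfolding good_def ev using F_top F_bot q(1) by (auto intro: divide_right_mono)
    then show ?thesis ..
  qed
  have good_ex: "\<exists>f. good f i j" if ij: "i \<in> Y" "j \<in> Y" "i \<noteq> j" for i j
  proof (cases "i < j")
    case False
    then obtain f where "good f j i" using good_less[OF ij(2,1)] ij(3) by auto
    then have "good (- f) i j" by (auto simp: good_def blinfun.minus_left)
    then show ?thesis ..
  qed (use good_less ij in blast)
  define S where "S = (\<lambda>n. y n /\<^sub>R R) ` Y"
  define d where "d = (1 + \<delta>) / q"
  have d: "1 < d" using q by (simp add: d_def)
  have "inj_on (\<lambda>n. y n /\<^sub>R R) Y"
  proof (rule inj_onI, rule ccontr)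
    fix i j assume "y i /\<^sub>R R = y j /\<^sub>R R" "i \<noteq> j"
    then have "y i = y j" using R by simp
    with sep'[OF \<open>i \<noteq> j\<close>] R \<delta> show False by (simp add: mult_le_0_iff)
  qed
  then have "infinite S" using Y by (simp add: S_def finite_image_iff)
  moreover have ball: "norm u \<le> 1" if "u \<in> S" for u
    using that bound R by (auto simp: S_def field_simps)
  moreover have "bsa 1 1 d S"
    unfolding bsa_def
  proof (intro conjI ballI impI)
    fix u v assume "u \<in> S" "v \<in> S" "u \<noteq> v"
    then obtain i j where ij: "i \<in> Y" "j \<in> Y" "i \<noteq> j" "u = y i /\<^sub>R R" "v = y j /\<^sub>R R"
      by (auto simp: S_def)
    obtain f where f: "good f j i" using good_ex[of j i] ij by blast
    have ev: "f (y n /\<^sub>R R) = f (y n) / R" for n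
      by (simp add: blinfun.scaleR_right divide_inverse mult.commute)
    have "d \<le> f v - f u"
      using f R unfolding good_def ij ev d_def by (simp add: field_simps)
    moreover have "f u \<le> f z \<and> f z \<le> f v" if "z \<in> S" for z
      using that f R unfolding good_def ij S_def by (auto simp: ev divide_right_mono)
    ultimately show "\<exists>f :: 'a \<Rightarrow>\<^sub>L real. norm f \<le> 1 \<and> d \<le> blinfun_apply f v - blinfun_apply f u \<and>
        (\<forall>z\<in>S. blinfun_apply f u \<le> blinfun_apply f z \<and> blinfun_apply f z \<le> blinfun_apply f v)"
      using f unfolding good_def by blast
  qed (use ball in auto)
  ultimately have "d \<in> Ka_set TYPE('a)"
    using d by (auto simp: Ka_set_def)
  then have "d \<le> Ka TYPE('a)"
    unfolding Ka_def by (rule cSup_upper[OF _ bdd_above_Ka_set])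
  with d show ?thesis by simp
qed

section \<open>Alternating sums\<close>

context basic_null_sequence
begin

definition alt :: "nat set \<Rightarrow> 'a" where
  "alt t = (\<Sum>i\<in>t. (-1) ^ card {j\<in>t. j < i} *\<^sub>R x i)"

text \<open>
  All partial sums count, in order that the bound be inherited by initial segments.
\<close>

definition adm :: "real \<Rightarrow> nat set \<Rightarrow> bool" where
  "adm C t \<longleftrightarrow> (\<forall>n. norm (alt (t \<inter> {..<n})) \<le> C)"

lemma alt_empty [simp]: "alt {} = 0"
  by (simp add: alt_def)

lemma alt_singleton [simp]: "alt {i} = x i"
proof -
  have *: "{j. j = i \<and> j < i} = {}" by auto
  show ?thesis by (simp add: alt_def *)
qed

lemma alt_Un:
  assumes "finite s" "finite t" "before s t"
  shows "alt (s \<union> t) = alt s + (-1) ^ card s *\<^sub>R alt t"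
proof -
  have disj: "s \<inter> t = {}" using assms(3) by (force simp: before_def)
  have "alt (s \<union> t) = (\<Sum>i\<in>s. (-1) ^ card {j\<in>s \<union> t. j < i} *\<^sub>R x i)
      + (\<Sum>i\<in>t. (-1) ^ card {j\<in>s \<union> t. j < i} *\<^sub>R x i)"
    unfolding alt_def by (rule sum.union_disjoint[OF assms(1,2) disj])
  also have "(\<Sum>i\<in>s. (-1) ^ card {j\<in>s \<union> t. j < i} *\<^sub>R x i) = alt s"
    unfolding alt_def
  proof (rule sum.cong[OF refl])
    fix i assume "i \<in> s"
    then have "{j\<in>s \<union> t. j < i} = {j\<in>s. j < i}" using assms(3) by (force simp: before_def)
    then show "(-1) ^ card {j\<in>s \<union> t. j < i} *\<^sub>R x i = (-1) ^ card {j\<in>s. j < i} *\<^sub>R x i" by simp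
  qed
  also have "(\<Sum>i\<in>t. (-1) ^ card {j\<in>s \<union> t. j < i} *\<^sub>R x i) = (-1) ^ card s *\<^sub>R alt t"
    unfolding alt_def scaleR_sum_right
  proof (rule sum.cong[OF refl])
    fix i assume "i \<in> t"
    then have "{j\<in>s \<union> t. j < i} = s \<union> {j\<in>t. j < i}" using assms(3) by (force simp: before_def)
    moreover have "card (s \<union> {j\<in>t. j < i}) = card s + card {j\<in>t. j < i}"
      using assms disj by (intro card_Un_disjoint) auto
    ultimately show "(-1) ^ card {j\<in>s \<union> t. j < i} *\<^sub>R x i
        = (-1) ^ card s *\<^sub>R (-1) ^ card {j\<in>t. j < i} *\<^sub>R x i"
      by (simp add: power_add)
  qed
  finally show ?thesis .
qed

lemma alt_insert:
  assumes "finite t" "\<forall>k\<in>t. k < n"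
  shows "alt (insert n t) = alt t + (-1) ^ card t *\<^sub>R x n"
  using alt_Un[of t "{n}"] assms by (simp add: before_def)

text \<open>
  The sole reason for alternating signs: after an odd set the sign pattern restarts with a minus, so that
  differences of alternating sums are again alternating sums.
\<close>

lemma alt_odd_Un:
  assumes "finite s" "finite t" "before s t" "odd (card s)"
  shows "alt (s \<union> t) = alt s - alt t"
  using alt_Un[OF assms(1-3)] assms(4) by simp

lemma initial_sum_bound:
  assumes "1 < \<rho>"
  shows "\<exists>n0. \<forall>t n a. finite t \<and> t \<subseteq> {n0..} \<longrightarrow>
    norm (\<Sum>i\<in>t \<inter> {..<n}. a i *\<^sub>R x i) \<le> \<rho> * norm (\<Sum>i\<in>t. a i *\<^sub>R x i)"
proof -
  obtain n0 where "1 / (\<rho> - 1) < real n0" using reals_Archimedean2 by blast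
  then have n0: "1 < (\<rho> - 1) * real n0" using assms by (simp add: field_simps)
  have n0: "basis_bound n \<le> \<rho>" if "n0 \<le> n" for n
  proof -
    have "(\<rho> - 1) * real n0 \<le> (\<rho> - 1) * (real n + 1)"
      using assms that by (intro mult_left_mono) auto
    then have "1 / (real n + 1) \<le> \<rho> - 1" using n0 by (simp add: divide_le_eq)
    then show ?thesis by (simp add: basis_bound_def)
  qed
  have "norm (\<Sum>i\<in>t \<inter> {..<n}. a i *\<^sub>R x i) \<le> \<rho> * norm (\<Sum>i\<in>t. a i *\<^sub>R x i)"
    if t: "finite t" "t \<subseteq> {n0..}" for t n a
  proof (cases "n0 \<le> n")
    case True
    have "norm (\<Sum>i\<in>t \<inter> {..<n}. a i *\<^sub>R x i) \<le> basis_bound n * norm (\<Sum>i\<in>t. a i *\<^sub>R x i)"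
      by (rule initial_segment_bound[OF t(1)])
    also have "\<dots> \<le> \<rho> * norm (\<Sum>i\<in>t. a i *\<^sub>R x i)" using n0[OF True] by (intro mult_right_mono) auto
    finally show ?thesis .
  next
    case False
    then have "t \<inter> {..<n} = {}" using t(2) by auto
    then show ?thesis using assms by simp
  qed
  then show ?thesis by blast
qed

lemma initial_alt_bound:
  assumes "1 < \<rho>"
  shows "\<exists>n0. \<forall>t n. finite t \<and> t \<subseteq> {n0..} \<longrightarrow> norm (alt (t \<inter> {..<n})) \<le> \<rho> * norm (alt t)"
proof -
  from initial_sum_bound[OF assms]
  obtain n0 where n0: "\<forall>t n a. finite t \<and> t \<subseteq> {n0..} \<longrightarrow>
    norm (\<Sum>i\<in>t \<inter> {..<n}. a i *\<^sub>R x i) \<le> \<rho> * norm (\<Sum>i\<in>t. a i *\<^sub>R x i)" ..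
  have "norm (alt (t \<inter> {..<n})) \<le> \<rho> * norm (alt t)" if "finite t \<and> t \<subseteq> {n0..}" for t n
  proof -
    have "alt (t \<inter> {..<n}) = (\<Sum>i\<in>t \<inter> {..<n}. (-1) ^ card {j\<in>t. j < i} *\<^sub>R x i)"
      unfolding alt_def
    proof (rule sum.cong[OF refl])
      fix i assume "i \<in> t \<inter> {..<n}"
      then have "{j\<in>t \<inter> {..<n}. j < i} = {j\<in>t. j < i}" by auto
      then show "(-1) ^ card {j\<in>t \<inter> {..<n}. j < i} *\<^sub>R x i = (-1) ^ card {j\<in>t. j < i} *\<^sub>R x i" by simp
    qed
    then show ?thesis
      using n0[rule_format, OF that, of "\<lambda>i. (-1) ^ card {j\<in>t. j < i}" n] by (simp add: alt_def)
  qed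
  then show ?thesis by blast
qed

lemma adm_initial: "adm C t \<Longrightarrow> norm (alt (t \<inter> {..<n})) \<le> C"
  by (simp add: adm_def)

lemma adm_norm:
  assumes "adm C t" "finite t"
  shows "norm (alt t) \<le> C"
proof -
  obtain n where "t \<subseteq> {..<n}" using assms(2) finite_nat_iff_bounded by blast
  then have "t \<inter> {..<n} = t" by blast
  then show ?thesis using adm_initial[OF assms(1), of n] by simp
qed

lemma adm_mono: "adm C t \<Longrightarrow> C \<le> C' \<Longrightarrow> adm C' t"
  using order_trans[OF adm_initial] unfolding adm_def by simp

lemma adm_initial_segment:
  assumes "adm C t"
  shows "adm C (t \<inter> {..<n})"
  unfolding adm_def
proof
  fix m
  have "t \<inter> {..<n} \<inter> {..<m} = t \<inter> {..<min n m}" by auto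
  then show "norm (alt (t \<inter> {..<n} \<inter> {..<m})) \<le> C" using adm_initial[OF assms] by simp
qed

lemma coordinates_of_alt:
  "\<exists>g :: nat \<Rightarrow> 'a \<Rightarrow>\<^sub>L real. \<forall>k. norm (g k) \<le> 4 \<and>
    (\<forall>i. blinfun_apply (g k) (x i) = (if i = k then 1 else 0)) \<and>
    (\<forall>t. finite t \<longrightarrow> blinfun_apply (g k) (alt t) = (if k \<in> t then (-1) ^ card {j\<in>t. j < k} else 0))"
proof -
  have "\<forall>k. \<exists>f :: 'a \<Rightarrow>\<^sub>L real. norm f \<le> 4 \<and> (\<forall>i. blinfun_apply f (x i) = (if i = k then 1 else 0))"
    using coordinate_functional by blast
  from choice[OF this] obtain g :: "nat \<Rightarrow> 'a \<Rightarrow>\<^sub>L real"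
    where g: "\<forall>k. norm (g k) \<le> 4 \<and> (\<forall>i. blinfun_apply (g k) (x i) = (if i = k then 1 else 0))" ..
  have "blinfun_apply (g k) (alt t) = (if k \<in> t then (-1) ^ card {j\<in>t. j < k} else 0)"
    if "finite t" for k t
  proof -
    have "blinfun_apply (g k) (alt t) = (\<Sum>i\<in>t. (-1) ^ card {j\<in>t. j < i} * (if i = k then 1 else 0))"
      unfolding alt_def by (simp add: blinfun.sum_right blinfun.scaleR_right g)
    also have "\<dots> = (\<Sum>i\<in>t. if i = k then (-1) ^ card {j\<in>t. j < k} else 0)"
      by (intro sum.cong) auto
    finally show ?thesis using that by simp
  qed
  with g show ?thesis by (intro exI[of _ g]) simp
qed

end

section \<open>Consequences of the absence of separated sequences\<close>

locale unseparated_sequence = basic_null_sequence x for x :: "nat \<Rightarrow> 'a::real_normed_vector" +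
  assumes Ka_le_one: "Ka TYPE('a) \<le> 1"
begin

text \<open>
  The coordinate functional at the first index of a block takes the value one on that block and zero on
  the others. Differences of two such functionals meet the requirement of \<open>Ka_gt_one_if_separated\<close>, so only
  the separation can fail.
\<close>

lemma close_blocks:
  fixes r :: "nat \<Rightarrow> nat set"
  assumes R: "0 < R" and \<rho>: "1 < \<rho>"
    and fin: "\<And>j. finite (r j)" and ne: "\<And>j. r j \<noteq> {}"
    and ord: "\<And>i j. i < j \<Longrightarrow> before (r i) (r j)" and bound: "\<And>j. norm (alt (r j)) \<le> R"
  shows "\<exists>i j. i < j \<and> norm (alt (r i) - alt (r j)) < R * \<rho>"
proof (rule ccontr)
  assume none: "\<not> ?thesis"
  from coordinates_of_alt obtain g :: "nat \<Rightarrow> 'a \<Rightarrow>\<^sub>L real" where "\<forall>k. norm (g k) \<le> 4 \<and>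
    (\<forall>i. blinfun_apply (g k) (x i) = (if i = k then 1 else 0)) \<and>
    (\<forall>t. finite t \<longrightarrow> blinfun_apply (g k) (alt t) = (if k \<in> t then (-1) ^ card {j\<in>t. j < k} else 0))" ..
  then have g: "\<And>k. norm (g k) \<le> 4"
    "\<And>k t. finite t \<Longrightarrow> blinfun_apply (g k) (alt t) = (if k \<in> t then (-1) ^ card {j\<in>t. j < k} else 0)"
    by simp_all
  define m where "m i = Min (r i)" for i
  have m: "m i \<in> r i" "\<And>k. k \<in> r i \<Longrightarrow> m i \<le> k" for i
    using fin ne by (auto simp: m_def)
  have g_alt: "g (m i) (alt (r k)) = (if k = i then 1 else 0)" for i k
  proof (cases "k = i")
    case True
    have first: "{j\<in>r i. j < m i} = {}" using m(2) by (auto simp: not_less)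
    have "g (m i) (alt (r i)) = (-1) ^ card {j\<in>r i. j < m i}"
      using g(2)[OF fin[of i], of "m i"] m(1) by simp
    also have "\<dots> = 1" by (simp only: first card.empty power_0)
    finally show ?thesis using True by simp
  next
    case False
    then have "m i \<notin> r k"
      using m(1)[of i] ord[of i k] ord[of k i] unfolding before_def by (metis less_irrefl nat_neq_iff)
    then show ?thesis using False g(2)[OF fin[of k]] by simp
  qed
  have "1 < Ka TYPE('a)"
  proof (rule Ka_gt_one_if_separated[where y = "\<lambda>j. alt (r j)" and R = R and \<delta> = "\<rho> - 1" and G = 8])
    show "R * (1 + (\<rho> - 1)) \<le> norm (alt (r i) - alt (r j))" if "i < j" for i j
    proof -
      have "\<not> norm (alt (r i) - alt (r j)) < R * \<rho>" using none that by blast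
      then show ?thesis by simp
    qed
  next
    fix i j :: nat assume ij: "i < j"
    have ev: "(g (m i) - g (m j)) (alt (r k)) = (if k = i then 1 else 0) - (if k = j then 1 else 0)" for k
      by (simp add: blinfun.diff_left g_alt)
    have "norm (g (m i) - g (m j)) \<le> 8"
      using norm_triangle_ineq4[of "g (m i)" "g (m j)"] g(1)[of "m i"] g(1)[of "m j"]
      by simp
    then show "\<exists>h :: 'a \<Rightarrow>\<^sub>L real. norm h \<le> 8 \<and>
        (\<forall>k. k \<noteq> i \<longrightarrow> blinfun_apply h (alt (r k)) + 1 \<le> blinfun_apply h (alt (r i))) \<and>
        (\<forall>k. k \<noteq> j \<longrightarrow> blinfun_apply h (alt (r j)) + 1 \<le> blinfun_apply h (alt (r k)))"
      using ij by (intro exI[of _ "g (m i) - g (m j)"]) (auto simp: ev)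
  qed (use R \<rho> bound in auto)
  then show False using Ka_le_one by simp
qed

lemma close_odd_blocks:
  fixes r :: "nat \<Rightarrow> nat set"
  assumes "0 < R" "1 < \<rho>" and fin: "\<And>j. finite (r j)" and odd: "\<And>j. odd (card (r j))"
    and ord: "\<And>i j. i < j \<Longrightarrow> before (r i) (r j)" and "\<And>j. norm (alt (r j)) \<le> R"
  shows "\<exists>i j. i < j \<and> norm (alt (r i \<union> r j)) < R * \<rho>"
proof -
  have "r j \<noteq> {}" for j using odd[of j] by auto
  then obtain i j where "i < j" "norm (alt (r i) - alt (r j)) < R * \<rho>"
    using close_blocks[of R \<rho> r] assms by blast
  then have "norm (alt (r i \<union> r j)) < R * \<rho>"
    using alt_odd_Un[OF fin fin ord odd, of i j] by simp
  with \<open>i < j\<close> show ?thesis by blast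
qed

text \<open>
  Singletons are close, so pairs have small alternating sums; pairs are close, which bounds
  \<open>x a - x b - x c + x d\<close>. The third term is then averaged out: with \<open>a\<close>, \<open>b\<close> and \<open>d\<close> fixed, \<open>c\<close>
  may run through a set between \<open>b\<close> and \<open>d\<close> that carries a small convex combination.
\<close>

lemma small_triples:
  assumes C: "1 < C" and N: "infinite N"
  shows "\<exists>M\<subseteq>N. infinite M \<and> (\<forall>a\<in>M. \<forall>b\<in>M. \<forall>c\<in>M. a < b \<longrightarrow> b < c \<longrightarrow> norm (alt {a, b, c}) \<le> C)"
proof -
  \<comment> \<open>Pairs are bounded by \<open>\<rho>\<close> and four-term sums by \<open>\<rho> * \<rho>\<close>; the rest of \<open>C\<close> is left for the
    averaged vector.\<close>
  define \<rho> where "\<rho> = root 3 C"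
  have \<rho>: "1 < \<rho>" "\<rho> ^ 3 = C" using C by (auto simp: \<rho>_def)
  have e: "0 < C - \<rho> * \<rho>"
    using \<rho> by (simp add: power3_eq_cube flip: \<rho>(2))
  have alt2: "alt {a, b} = x a - x b" if "a < b" for a b
    using alt_insert[of "{a}" b] that by (simp add: insert_commute)
  have alt3: "alt {a, b, c} = x a - x b + x c" if "a < b" "b < c" for a b c
    using alt_insert[of "{a, b}" c] that alt2[OF that(1)] by (simp add: insert_commute)
  define P2 where "P2 X \<longleftrightarrow> norm (alt X) \<le> \<rho>" for X
  have "\<exists>X\<subseteq>M. finite X \<and> card X = 2 \<and> P2 X" if M: "infinite M" for M
  proof -
    define e where "e = enumerate M"
    have e: "strict_mono e" "\<And>i. e i \<in> M"
      using M by (auto simp: e_def strict_mono_enumerate enumerate_in_set)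
    have "\<exists>i j. i < j \<and> norm (alt {e i} - alt {e j}) < 1 * \<rho>"
      by (rule close_blocks) (use \<rho> e(1) in \<open>auto simp: before_def norm_x strict_mono_less\<close>)
    then obtain i j where ij: "i < j" "norm (x (e i) - x (e j)) < \<rho>" by auto
    then have "e i < e j" using e(1) by (simp add: strict_mono_less)
    then show ?thesis
      using ij e(2) by (intro exI[of _ "{e i, e j}"]) (auto simp: P2_def alt2)
  qed
  then obtain M1 where M1: "M1 \<subseteq> N" "infinite M1" and P2: "\<forall>X. X \<subseteq> M1 \<and> finite X \<and> card X = 2 \<longrightarrow> P2 X"
    using ramsey_of_dense_property[OF N, of 2 P2] by blast
  define P4 where "P4 X \<longleftrightarrow> (\<forall>a b c d. X = {a, b, c, d} \<longrightarrow> a < b \<longrightarrow> b < c \<longrightarrow> c < d \<longrightarrow>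
    norm (x a - x b - x c + x d) \<le> \<rho> * \<rho>)" for X
  have "\<exists>X\<subseteq>M. finite X \<and> card X = 4 \<and> P4 X" if M: "M \<subseteq> M1" "infinite M" for M
  proof -
    define e where "e = enumerate M"
    have e: "strict_mono e" "\<And>i. e i \<in> M"
      using M by (auto simp: e_def strict_mono_enumerate enumerate_in_set)
    have pair: "e (2 * i) < e (Suc (2 * i))" for i using e(1) by (simp add: strict_mono_less)
    have "norm (alt {e (2 * i), e (Suc (2 * i))}) \<le> \<rho>" for i
      using P2[rule_format, of "{e (2 * i), e (Suc (2 * i))}"] e(2) M(1) pair[of i]
      by (auto simp: P2_def card_insert_if)
    moreover have "before {e (2 * i), e (Suc (2 * i))} {e (2 * j), e (Suc (2 * j))}" if "i < j" for i j
      using that e(1) by (auto simp: before_def strict_mono_less)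
    ultimately have "\<exists>i j. i < j \<and> norm (alt {e (2 * i), e (Suc (2 * i))} - alt {e (2 * j), e (Suc (2 * j))}) < \<rho> * \<rho>"
      using \<rho>(1) by (intro close_blocks) auto
    then obtain i j where ij: "i < j"
      and le: "norm (alt {e (2 * i), e (Suc (2 * i))} - alt {e (2 * j), e (Suc (2 * j))}) < \<rho> * \<rho>" by blast
    have ord: "e (2 * i) < e (Suc (2 * i))" "e (Suc (2 * i)) < e (2 * j)" "e (2 * j) < e (Suc (2 * j))"
      using pair ij e(1) by (auto simp: strict_mono_less)
    let ?X = "{e (2 * i), e (Suc (2 * i)), e (2 * j), e (Suc (2 * j))}"
    have "P4 ?X"
      unfolding P4_def
    proof (intro allI impI)
      fix a b c d assume eq: "?X = {a, b, c, d}" and abcd: "a < b" "b < c" "c < d"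
      have "[a, b, c, d] = [e (2 * i), e (Suc (2 * i)), e (2 * j), e (Suc (2 * j))]"
        by (rule sorted_distinct_set_unique) (use ord abcd eq in auto)
      then show "norm (x a - x b - x c + x d) \<le> \<rho> * \<rho>"
        using le ord by (simp add: alt2 algebra_simps)
    qed
    moreover have "card ?X = 4" using ord by simp
    ultimately show ?thesis using e(2) by (intro exI[of _ ?X]) simp
  qed
  then obtain M2 where M2: "M2 \<subseteq> M1" "infinite M2" and P4: "\<forall>X. X \<subseteq> M2 \<and> finite X \<and> card X = 4 \<longrightarrow> P4 X"
    using ramsey_of_dense_property[OF M1(2), of 4 P4] by blast
  define P3 where "P3 X \<longleftrightarrow> norm (alt X) \<le> C" for X
  have "\<exists>X\<subseteq>M. finite X \<and> card X = 3 \<and> P3 X" if M: "M \<subseteq> M2" "infinite M" for M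
  proof -
    obtain a where a: "a \<in> M" using M(2) by (metis ex_in_conv finite.emptyI)
    obtain b where b: "b \<in> M" "a < b" using M(2) by (meson infinite_nat_iff_unbounded)
    obtain A y where A: "finite A" "A \<subseteq> {m\<in>M. \<forall>k\<in>{a, b}. k < m}" "y \<in> convex hull (x ` A)"
        "norm y < C - \<rho> * \<rho>"
      using small_convex_combination[OF infinite_tail[OF M(2), of "{a, b}"] e] by auto
    obtain d where d: "d \<in> M" "\<forall>k\<in>insert b A. k < d"
      using infinite_tail[OF M(2), of "insert b A"] A(1) by (metis (no_types, lifting) equals0I finite.emptyI finite.insertI mem_Collect_eq)
    have "x ` A \<subseteq> cball (x a - x b + x d) (\<rho> * \<rho>)"
    proof
      fix v assume "v \<in> x ` A"
      then obtain c where c: "c \<in> A" "v = x c" by blast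
      then have "b < c" "c < d" "c \<in> M" using A(2) d(2) by auto
      then have "P4 {a, b, c, d}"
        using P4[rule_format, of "{a, b, c, d}"] M(1) a b d(1) by auto
      then have "norm (x a - x b - x c + x d) \<le> \<rho> * \<rho>"
        using b(2) \<open>b < c\<close> \<open>c < d\<close> unfolding P4_def by blast
      then show "v \<in> cball (x a - x b + x d) (\<rho> * \<rho>)"
        by (simp add: c(2) dist_norm algebra_simps)
    qed
    then have "y \<in> cball (x a - x b + x d) (\<rho> * \<rho>)"
      using A(3) hull_minimal[of "x ` A" _ convex] convex_cball by blast
    then have "norm (x a - x b + x d - y) \<le> \<rho> * \<rho>" by (simp add: dist_norm)
    then have "norm (x a - x b + x d) \<le> C"
      using norm_triangle_ineq[of "x a - x b + x d - y" y] A(4) by simp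
    moreover have "b < d" using d(2) by simp
    ultimately show ?thesis
      using a b d(1) by (intro exI[of _ "{a, b, d}"]) (simp add: P3_def alt3)
  qed
  then obtain M3 where M3: "M3 \<subseteq> M2" "infinite M3" and P3: "\<forall>X. X \<subseteq> M3 \<and> finite X \<and> card X = 3 \<longrightarrow> P3 X"
    using ramsey_of_dense_property[OF M2(2), of 3 P3] by blast
  have "norm (alt {a, b, c}) \<le> C" if "a \<in> M3" "b \<in> M3" "c \<in> M3" "a < b" "b < c" for a b c
    using P3[rule_format, of "{a, b, c}"] that by (simp add: P3_def)
  then show ?thesis using M1 M2 M3 by (intro exI[of _ M3]) blast
qed

text \<open>
  Appending two indices to an odd admissible set cannot suddenly increase the norm when the first of them did not.
  Otherwise, by Galvin's lemma, every infinite set has an initial segment from which all pairs of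
  later indices jump. Cutting a set into successive segments \<open>r j\<close> of this kind, one sees
  the first two elements of \<open>r j\<close> jump from \<open>r i\<close>, whence \<open>alt (r i \<union> r j)\<close> is large for all \<open>i < j\<close>.
\<close>

lemma no_jump:
  assumes C': "0 < C'" "C' < C''" and C'': "1 < C''" and N: "infinite N"
  shows "\<exists>M\<subseteq>N. infinite M \<and> (\<forall>r n n'. finite r \<longrightarrow> r \<subseteq> M \<longrightarrow> odd (card r) \<longrightarrow> adm C' r \<longrightarrow>
    n \<in> M \<longrightarrow> n' \<in> M \<longrightarrow> (\<forall>k\<in>r. k < n) \<longrightarrow> n < n' \<longrightarrow> norm (alt (insert n r)) \<le> C' \<longrightarrow>
    norm (alt (insert n' (insert n r))) \<le> C'')"
proof -
  define jump where "jump r n n' \<longleftrightarrow>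
    norm (alt (insert n r)) \<le> C' \<and> C'' < norm (alt (insert n' (insert n r)))" for r n n'
  \<comment> \<open>One factor \<open>\<rho>\<close> pays for passing to an initial segment, the other one is the separation.\<close>
  define \<rho> where "\<rho> = sqrt (C'' / C')"
  have "1 < \<rho>" using C' by (simp add: \<rho>_def)
  moreover have "\<rho> * \<rho> = C'' / C'" using C' by (simp add: \<rho>_def)
  ultimately have \<rho>: "1 < \<rho>" "C' * \<rho> * \<rho> = C''" using C' by (simp_all add: mult.assoc)
  obtain n0 where n0: "\<And>t n. finite t \<Longrightarrow> t \<subseteq> {n0..} \<Longrightarrow> norm (alt (t \<inter> {..<n})) \<le> \<rho> * norm (alt t)"
    using initial_alt_bound[OF \<rho>(1)] by blast
  have "infinite {m\<in>N. \<forall>k\<in>{..n0}. k < m}" by (rule infinite_tail[OF N]) simp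
  from small_triples[OF C'' this] obtain M0 where M0: "M0 \<subseteq> {m\<in>N. \<forall>k\<in>{..n0}. k < m}" "infinite M0"
    and triple: "\<forall>a\<in>M0. \<forall>b\<in>M0. \<forall>c\<in>M0. a < b \<longrightarrow> b < c \<longrightarrow> norm (alt {a, b, c}) \<le> C''" by blast
  have M0_n0: "M0 \<subseteq> {n0..}" using M0(1) by fastforce
  let ?Q = "\<lambda>r B. (\<forall>n\<in>B. \<forall>n'\<in>B. n < n' \<longrightarrow> jump r n n') \<or> (\<forall>n\<in>B. \<forall>n'\<in>B. n < n' \<longrightarrow> \<not> jump r n n')"
  obtain M1 where M1: "M1 \<subseteq> M0" "infinite M1"
    and Q: "\<And>r. finite r \<Longrightarrow> r \<subseteq> M1 \<Longrightarrow> ?Q r {m\<in>M1. \<forall>k\<in>r. k < m}"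
  proof (rule fusion[OF M0(2), of ?Q])
    fix r A :: "nat set" assume "infinite A"
    then show "\<exists>B\<subseteq>A. infinite B \<and> ?Q r B" by (rule ramsey_pairs_dichotomy)
  next
    fix r A B :: "nat set" assume Q: "?Q r A" and "B \<subseteq> A"
    then have sub: "\<And>n. n \<in> B \<Longrightarrow> n \<in> A" by blast
    from Q show "?Q r B"
    proof
      assume "\<forall>n\<in>A. \<forall>n'\<in>A. n < n' \<longrightarrow> jump r n n'"
      then show ?thesis using sub by simp
    next
      assume "\<forall>n\<in>A. \<forall>n'\<in>A. n < n' \<longrightarrow> \<not> jump r n n'"
      then show ?thesis using sub by simp
    qed
  qed (rule that; assumption)
  define F where "F r \<longleftrightarrow> odd (card r) \<and> adm C' r \<and>
    (\<forall>n\<in>M1. \<forall>n'\<in>M1. (\<forall>k\<in>r. k < n) \<longrightarrow> n < n' \<longrightarrow> jump r n n')" for r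
  consider M where "M \<subseteq> M1" "infinite M" "\<And>t. finite t \<Longrightarrow> t \<subseteq> M \<Longrightarrow> \<not> F t"
    | M where "M \<subseteq> M1" "infinite M" "\<And>L. L \<subseteq> M \<Longrightarrow> infinite L \<Longrightarrow> \<exists>n. F (L \<inter> {..<n})"
    by (rule galvin[OF M1(2), of F]) blast+
  then show ?thesis
  proof cases
    case (1 M)
    have "norm (alt (insert n' (insert n r))) \<le> C''"
      if r: "finite r" "r \<subseteq> M" "odd (card r)" "adm C' r" and n: "n \<in> M" "n' \<in> M" "\<forall>k\<in>r. k < n" "n < n'"
        "norm (alt (insert n r)) \<le> C'" for r n n'
    proof -
      have "\<not> F r" by (rule 1(3)[OF r(1,2)])
      then obtain p p' where p: "p \<in> M1" "p' \<in> M1" "\<forall>k\<in>r. k < p" "p < p'" "\<not> jump r p p'"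
        using r by (auto simp: F_def)
      then have "\<not> (\<forall>n\<in>{m\<in>M1. \<forall>k\<in>r. k < m}. \<forall>n'\<in>{m\<in>M1. \<forall>k\<in>r. k < m}. n < n' \<longrightarrow> jump r n n')"
        by fastforce
      then have "\<forall>n\<in>{m\<in>M1. \<forall>k\<in>r. k < m}. \<forall>n'\<in>{m\<in>M1. \<forall>k\<in>r. k < m}. n < n' \<longrightarrow> \<not> jump r n n'"
        using Q[of r] r 1(1) by blast
      moreover have "n \<in> {m\<in>M1. \<forall>k\<in>r. k < m}" "n' \<in> {m\<in>M1. \<forall>k\<in>r. k < m}"
        using n 1(1) by auto
      ultimately have "\<not> jump r n n'" using n(4) by blast
      then show ?thesis using n(5) by (simp add: jump_def)
    qed
    moreover have "M \<subseteq> N" using 1(1) M1(1) M0(1) by blast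
    ultimately show ?thesis using 1(2) by (intro exI[of _ M]) blast
  next
    case (2 M)
    have "\<exists>r :: nat \<Rightarrow> nat set. \<forall>j. (finite (r j) \<and> r j \<noteq> {} \<and> r j \<subseteq> M \<and> F (r j)) \<and>
        (\<forall>i<j. before (r i) (r j) \<and> True)"
    proof (rule block_sequence[OF 2(2)])
      fix L assume "L \<subseteq> M" "infinite L"
      then obtain n where "F (L \<inter> {..<n})" using 2(3) by blast
      moreover from this have "L \<inter> {..<n} \<noteq> {}" by (force simp: F_def)
      ultimately have "finite (L \<inter> {..<n}) \<and> L \<inter> {..<n} \<noteq> {} \<and> L \<inter> {..<n} \<subseteq> L \<and> F (L \<inter> {..<n})" by simp
      then show "\<exists>t. finite t \<and> t \<noteq> {} \<and> t \<subseteq> L \<and> F t \<and> (\<forall>s\<in>S. True)" for S :: "nat set set" by blast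
    qed
    then obtain r :: "nat \<Rightarrow> nat set" where r: "\<And>j. finite (r j)" "\<And>j. r j \<subseteq> M" "\<And>j. F (r j)"
      and ord: "\<And>i j. i < j \<Longrightarrow> before (r i) (r j)" by blast
    have "norm (alt (r j)) \<le> C'" for j using r(1,3) adm_norm by (simp add: F_def)
    then have "\<exists>i j. i < j \<and> norm (alt (r i \<union> r j)) < C' * \<rho>"
      using C'(1) \<rho>(1) r ord by (intro close_odd_blocks) (auto simp: F_def)
    then obtain i j where ij: "i < j" "norm (alt (r i \<union> r j)) < C' * \<rho>" by blast
    have rM1: "r k \<subseteq> M1" for k using r(2) 2(1) by blast
    \<comment> \<open>A single index cannot jump, because triples are small.\<close>
    have "card (r j) \<noteq> 1"
    proof
      assume "card (r j) = 1"
      then obtain a where a: "r j = {a}" by (auto simp: card_1_singleton_iff)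
      obtain p where p: "p \<in> M1" "a < p" using M1(2) by (meson infinite_nat_iff_unbounded)
      obtain p' where p': "p' \<in> M1" "p < p'" using M1(2) by (meson infinite_nat_iff_unbounded)
      have "jump {a} p p'" using r(3)[of j] p p' by (simp add: F_def a)
      moreover have "insert p' (insert p {a}) = {a, p, p'}" by auto
      moreover have "norm (alt {a, p, p'}) \<le> C''"
        using triple p p' M1(1) rM1[of j] a by blast
      ultimately show False by (simp add: jump_def)
    qed
    define n where "n = Min (r j)"
    define n' where "n' = Min (r j - {n})"
    have "r j \<noteq> {}" using r(3)[of j] by (auto simp: F_def)
    then have n: "n \<in> r j" "\<And>k. k \<in> r j \<Longrightarrow> n \<le> k" using r(1) by (auto simp: n_def)
    have "r j - {n} \<noteq> {}"
      using n(1) \<open>card (r j) \<noteq> 1\<close> by (metis card_1_singleton_iff insert_Diff One_nat_def)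
    moreover have "finite (r j - {n})" using r(1) by simp
    ultimately have n': "n' \<in> r j - {n}" "\<And>k. k \<in> r j - {n} \<Longrightarrow> n' \<le> k"
      unfolding n'_def by (metis Min_in, metis Min_le)
    have nn': "n < n'" using n n' by (metis DiffD1 DiffD2 insertI1 le_neq_implies_less)
    have low: "k \<le> n'" if "k \<in> r i" for k
      using ord[OF ij(1)] n'(1) that by (auto simp: before_def intro: less_imp_le)
    have two: "k = n \<or> k = n'" if "k \<in> r j" "k \<le> n'" for k
      using n'(2)[of k] that by (cases "k = n") auto
    have "jump (r i) n n'"
    proof -
      have "n \<in> M1" "n' \<in> M1" using n(1) n'(1) rM1[of j] by auto
      moreover have "\<forall>k\<in>r i. k < n" using ord[OF ij(1)] n(1) by (simp add: before_def)
      ultimately show ?thesis using r(3)[of i] nn' unfolding F_def by blast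
    qed
    then have "C'' < norm (alt (insert n' (insert n (r i))))" by (simp add: jump_def)
    also have "insert n' (insert n (r i)) = (r i \<union> r j) \<inter> {..<Suc n'}"
    proof (intro set_eqI iffI)
      show "k \<in> (r i \<union> r j) \<inter> {..<Suc n'}" if "k \<in> insert n' (insert n (r i))" for k
        using that n(1) n'(1) nn' low by (auto simp: less_Suc_eq_le)
      show "k \<in> insert n' (insert n (r i))" if "k \<in> (r i \<union> r j) \<inter> {..<Suc n'}" for k
        using that two[of k] by (auto simp: less_Suc_eq_le)
    qed
    also have "norm (alt \<dots>) \<le> \<rho> * norm (alt (r i \<union> r j))"
      using r(1) rM1 M1(1) M0_n0 by (intro n0) blast+
    also have "\<dots> < \<rho> * (C' * \<rho>)" using ij(2) \<rho>(1) by simp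
    finally have False using \<rho>(2) by (simp add: mult_ac)
    then show ?thesis ..
  qed
qed

text \<open>
  If no \<open>s\<close> works, Galvin's lemma and fusion give a set in which, for each odd admissible \<open>s\<close>, every infinite set
  to the right of \<open>s\<close> has an admissible initial segment \<open>t\<close> with \<open>alt (s \<union> t)\<close> large. One initial segment
  serves all predecessors of a block sequence simultaneously: the longest of theirs, as largeness essentially
  persists when \<open>t\<close> grows. It can be given odd size, since one more index may be appended by \<open>no_jump\<close>.
  The resulting odd blocks contradict \<open>close_odd_blocks\<close>.
\<close>

lemma admissible_extension:
  assumes C': "1 < C'" "C' < C" and N: "infinite N"
  shows "\<exists>s M. finite s \<and> s \<subseteq> N \<and> odd (card s) \<and> M \<subseteq> N \<and> infinite M \<and> before s M \<and>
    (\<forall>t. finite t \<longrightarrow> t \<subseteq> M \<longrightarrow> adm C' t \<longrightarrow> adm C (s \<union> t))"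
proof (rule ccontr)
  assume none: "\<not> ?thesis"
  \<comment> \<open>The quotient is spent in three equal parts: on making the size of a block odd, on the separation, and
    on passing to initial segments.\<close>
  define \<rho> where "\<rho> = root 3 (C / C')"
  have "1 < \<rho>" "\<rho> ^ 3 = C / C'" using C' by (auto simp: \<rho>_def)
  then have \<rho>: "1 < \<rho>" "\<rho> * (\<rho> * (\<rho> * C')) = C" using C' by (simp_all add: power3_eq_cube field_simps)
  define C'' where "C'' = \<rho> * C'"
  have C'': "C' < C''" "1 < C''" "\<rho> * (\<rho> * C'') = C" using \<rho> C' by (simp_all add: C''_def less_1_mult)
  have "C'' < \<rho> * C''" "\<rho> * C'' < \<rho> * (\<rho> * C'')" using \<rho>(1) C''(2) by simp_all
  then have C''C: "C'' < C" using C''(3) by simp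
  obtain n0 where n0: "\<And>t n. finite t \<Longrightarrow> t \<subseteq> {n0..} \<Longrightarrow> norm (alt (t \<inter> {..<n})) \<le> \<rho> * norm (alt t)"
    using initial_alt_bound[OF \<rho>(1)] by blast
  have "infinite {m\<in>N. \<forall>k\<in>{..n0}. k < m}" by (rule infinite_tail[OF N]) simp
  with no_jump[of C' C'' "{m\<in>N. \<forall>k\<in>{..n0}. k < m}"] C' C''
  obtain N1 where N1: "N1 \<subseteq> {m\<in>N. \<forall>k\<in>{..n0}. k < m}" "infinite N1"
    and no_jump: "\<And>r n n'. finite r \<Longrightarrow> r \<subseteq> N1 \<Longrightarrow> odd (card r) \<Longrightarrow> adm C' r \<Longrightarrow>
    n \<in> N1 \<Longrightarrow> n' \<in> N1 \<Longrightarrow> (\<forall>k\<in>r. k < n) \<Longrightarrow> n < n' \<Longrightarrow> norm (alt (insert n r)) \<le> C' \<Longrightarrow>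
    norm (alt (insert n' (insert n r))) \<le> C''" by force
  have N1_N: "N1 \<subseteq> N" and N1_n0: "N1 \<subseteq> {n0..}" using N1(1) by fastforce+
  define good where "good s \<longleftrightarrow> odd (card s) \<and> adm C'' s" for s
  define bad where "bad s t \<longleftrightarrow> adm C' t \<and> C < norm (alt (s \<union> t))" for s t
  have bad_ex: "\<exists>B\<subseteq>A. infinite B \<and> (\<forall>L\<subseteq>B. infinite L \<longrightarrow> (\<exists>n. bad s (L \<inter> {..<n})))"
    if s: "finite s" "s \<subseteq> N1" "good s" and A: "infinite A" "A \<subseteq> N1" for s A
  proof -
    define A' where "A' = {m\<in>A. \<forall>k\<in>s. k < m}"
    have A': "infinite A'" unfolding A'_def by (rule infinite_tail[OF A(1) s(1)])
    consider M where "M \<subseteq> A'" "infinite M" "\<And>t. finite t \<Longrightarrow> t \<subseteq> M \<Longrightarrow> \<not> bad s t"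
      | M where "M \<subseteq> A'" "infinite M" "\<And>L. L \<subseteq> M \<Longrightarrow> infinite L \<Longrightarrow> \<exists>n. bad s (L \<inter> {..<n})"
      by (rule galvin[OF A', of "bad s"]) blast+
    then show ?thesis
    proof cases
      case (1 M)
      have sM: "before s M" using 1(1) by (auto simp: before_def A'_def)
      have "adm C (s \<union> t)" if t: "finite t" "t \<subseteq> M" "adm C' t" for t
        unfolding adm_def
      proof
        fix n
        show "norm (alt ((s \<union> t) \<inter> {..<n})) \<le> C"
        proof (cases "t \<inter> {..<n} = {}")
          case True
          then have "(s \<union> t) \<inter> {..<n} = s \<inter> {..<n}" by blast
          moreover have "norm (alt (s \<inter> {..<n})) \<le> C''" using s(3) by (simp add: good_def adm_initial)
          ultimately show ?thesis using C''C by simp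
        next
          case False
          then have "s \<subseteq> {..<n}" using sM t(2) by (force simp: before_def)
          then have "(s \<union> t) \<inter> {..<n} = s \<union> (t \<inter> {..<n})" by blast
          moreover have "\<not> bad s (t \<inter> {..<n})" using t by (intro 1(3)) auto
          ultimately show ?thesis using adm_initial_segment[OF t(3), of n] by (simp add: bad_def)
        qed
      qed
      moreover have "M \<subseteq> N" "s \<subseteq> N" using 1(1) A(2) s(2) N1_N by (auto simp: A'_def)
      ultimately have "finite s \<and> s \<subseteq> N \<and> odd (card s) \<and> M \<subseteq> N \<and> infinite M \<and> before s M \<and>
          (\<forall>t. finite t \<longrightarrow> t \<subseteq> M \<longrightarrow> adm C' t \<longrightarrow> adm C (s \<union> t))"
        using s 1(2) sM by (simp add: good_def)
      then have False using none by blast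
      then show ?thesis ..
    next
      case (2 M)
      then show ?thesis by (intro exI[of _ M]) (auto simp: A'_def)
    qed
  qed
  let ?Q = "\<lambda>s B. s \<subseteq> N1 \<longrightarrow> good s \<longrightarrow> (\<forall>L\<subseteq>B. infinite L \<longrightarrow> (\<exists>n. bad s (L \<inter> {..<n})))"
  obtain N2 where N2: "N2 \<subseteq> N1" "infinite N2"
    and Q: "\<And>s. finite s \<Longrightarrow> s \<subseteq> N2 \<Longrightarrow> ?Q s {m\<in>N2. \<forall>k\<in>s. k < m}"
  proof (rule fusion[OF N1(2), of ?Q])
    fix s A :: "nat set" assume "finite s" "infinite A" "A \<subseteq> N1"
    then show "\<exists>B\<subseteq>A. infinite B \<and> ?Q s B"
      using bad_ex[of s A] by (cases "s \<subseteq> N1 \<and> good s") blast+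
  next
    fix s A B :: "nat set" assume Q: "?Q s A" and BA: "B \<subseteq> A"
    show "?Q s B"
    proof (intro impI allI)
      fix L assume "s \<subseteq> N1" "good s" "L \<subseteq> B" "infinite L"
      moreover from this BA have "L \<subseteq> A" by blast
      ultimately show "\<exists>n. bad s (L \<inter> {..<n})" using Q by simp
    qed
  qed (rule that; assumption)
  have "\<exists>r :: nat \<Rightarrow> nat set. \<forall>j. (finite (r j) \<and> r j \<noteq> {} \<and> r j \<subseteq> N2 \<and> good (r j)) \<and>
      (\<forall>i<j. before (r i) (r j) \<and> C < \<rho> * norm (alt (r i \<union> r j)))"
  proof (rule block_sequence[OF N2(2)])
    fix S L assume S: "finite S" "\<forall>s\<in>S. finite s \<and> s \<noteq> {} \<and> s \<subseteq> N2 \<and> good s \<and> before s L"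
      and L: "L \<subseteq> N2" "infinite L"
    have "\<exists>n. bad s (L \<inter> {..<n})" if s: "s \<in> S" for s
    proof -
      have s': "finite s" "s \<subseteq> N2" "good s" "before s L" using S(2) s by blast+
      moreover have "s \<subseteq> N1" using s'(2) N2(1) by blast
      moreover have "L \<subseteq> {m\<in>N2. \<forall>k\<in>s. k < m}" using s'(4) L(1) by (auto simp: before_def)
      ultimately show ?thesis using Q[of s] L(2) by simp
    qed
    then obtain n where n: "\<And>s. s \<in> S \<Longrightarrow> bad s (L \<inter> {..<n s})" by metis
    show "\<exists>t. finite t \<and> t \<noteq> {} \<and> t \<subseteq> L \<and> good t \<and> (\<forall>s\<in>S. C < \<rho> * norm (alt (s \<union> t)))"
    proof (cases "S = {}")
      case True
      obtain a where "a \<in> L" using L(2) by (metis ex_in_conv finite.emptyI)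
      moreover have "good {a}"
      proof -
        have "norm (alt ({a} \<inter> {..<m})) \<le> C''" for m using C''(2) by (cases "a < m") (auto simp: norm_x)
        then show ?thesis by (simp add: good_def adm_def)
      qed
      ultimately show ?thesis using True by (intro exI[of _ "{a}"]) simp
    next
      case False
      define m where "m = Max (n ` S)"
      have nm: "n s \<le> m" if "s \<in> S" for s using S(1) that by (simp add: m_def)
      have "m \<in> n ` S" unfolding m_def using S(1) False by (intro Max_in) auto
      then obtain s0 where s0: "s0 \<in> S" "m = n s0" by blast
      define t0 where "t0 = L \<inter> {..<m}"
      have t0: "finite t0" "t0 \<subseteq> L" "adm C' t0" using n[OF s0(1)] by (auto simp: t0_def bad_def s0(2))
      \<comment> \<open>Whatever is appended to \<open>t0\<close>, the badness for each \<open>s\<close> survives up to the factor \<open>\<rho>\<close>.\<close>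
      have far: "C < \<rho> * norm (alt (s \<union> t))" if s: "s \<in> S" and t: "finite t" "t \<subseteq> L" "t \<inter> {..<m} = t0" for s t
      proof -
        have ne: "L \<inter> {..<n s} \<noteq> {}"
        proof
          assume "L \<inter> {..<n s} = {}"
          then have "C < norm (alt s)" using n[OF s] by (simp add: bad_def)
          moreover have "norm (alt s) \<le> C''" using S(2) s by (auto simp: good_def intro: adm_norm)
          ultimately show False using C''C by simp
        qed
        then have "s \<subseteq> {..<n s}" using S(2) s by (force simp: before_def)
        moreover have "t \<inter> {..<n s} = t0 \<inter> {..<n s}" using t(3) nm[OF s] by force
        moreover have "t0 \<inter> {..<n s} = L \<inter> {..<n s}" using nm[OF s] by (auto simp: t0_def)
        ultimately have eq: "s \<union> (L \<inter> {..<n s}) = (s \<union> t) \<inter> {..<n s}" by blast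
        have "finite s" "s \<subseteq> N2" using S(2) s by blast+
        moreover have "t \<subseteq> N2" using t(2) L(1) by blast
        ultimately have st: "finite (s \<union> t)" "s \<union> t \<subseteq> {n0..}" using t(1) N2(1) N1_n0 by auto
        have "C < norm (alt (s \<union> (L \<inter> {..<n s})))" using n[OF s] by (simp add: bad_def)
        also have "\<dots> \<le> \<rho> * norm (alt (s \<union> t))"
          unfolding eq by (rule n0[OF st])
        finally show ?thesis .
      qed
      have "t0 \<noteq> {}"
      proof
        assume "t0 = {}"
        then have "C < norm (alt s0)" using n[OF s0(1)] by (simp add: bad_def t0_def s0(2))
        moreover have "norm (alt s0) \<le> C''" using S(2) s0(1) by (auto simp: good_def intro: adm_norm)
        ultimately show False using C''C by simp
      qed
      show ?thesis
      proof (cases "odd (card t0)")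
        case True
        have "good t0" using True adm_mono[OF t0(3)] C''(1) by (simp add: good_def)
        moreover have "t0 \<inter> {..<m} = t0" by (auto simp: t0_def)
        ultimately show ?thesis
          using t0 \<open>t0 \<noteq> {}\<close> far by (intro exI[of _ t0]) blast
      next
        case False
        obtain l where l: "l \<in> L" "m \<le> l" using L(2) by (meson infinite_nat_iff_unbounded_le)
        define n' where "n' = Max t0"
        have n': "n' \<in> t0" "\<And>k. k \<in> t0 \<Longrightarrow> k \<le> n'" using t0(1) \<open>t0 \<noteq> {}\<close> by (auto simp: n'_def)
        define r where "r = t0 - {n'}"
        have r: "finite r" "insert n' r = t0" "\<forall>k\<in>r. k < n'" "n' \<notin> r"
          using t0(1) n' by (auto simp: r_def less_le)
        have "odd (card r)" using False r by (metis card_insert_disjoint even_Suc)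
        moreover have "adm C' r"
        proof -
          have "r = t0 \<inter> {..<n'}" using r(3) by (auto simp: r_def)
          then show ?thesis using adm_initial_segment[OF t0(3)] by simp
        qed
        moreover have t0l: "\<forall>k\<in>t0. k < l" using l(2) by (auto simp: t0_def)
        moreover have "t0 \<subseteq> N1" "l \<in> N1" using t0(2) l(1) L(1) N2(1) by auto
        moreover have "norm (alt t0) \<le> C'" by (rule adm_norm[OF t0(3,1)])
        ultimately have jump: "norm (alt (insert l t0)) \<le> C''"
          using no_jump[of r n' l] r n'(1) by (auto simp: r_def)
        have "adm C'' (insert l t0)"
          unfolding adm_def
        proof
          fix k
          show "norm (alt (insert l t0 \<inter> {..<k})) \<le> C''"
          proof (cases "l < k")
            case True
            then have "insert l t0 \<inter> {..<k} = insert l t0" using t0l by force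
            then show ?thesis using jump by simp
          next
            case False
            then have "insert l t0 \<inter> {..<k} = t0 \<inter> {..<k}" by auto
            then show ?thesis using adm_initial[OF t0(3), of k] C''(1) by simp
          qed
        qed
        moreover have "card (insert l t0) = Suc (card t0)" using t0(1) t0l by (intro card_insert_disjoint) auto
        ultimately have "good (insert l t0)" using False by (simp add: good_def)
        moreover have "insert l t0 \<inter> {..<m} = t0" using l(2) by (auto simp: t0_def)
        moreover have "finite (insert l t0)" "insert l t0 \<subseteq> L" using t0 l by auto
        ultimately show ?thesis
          using far by (intro exI[of _ "insert l t0"]) blast
      qed
    qed
  qed
  then obtain r :: "nat \<Rightarrow> nat set" where r: "\<And>j. finite (r j)" "\<And>j. good (r j)"
    and ord: "\<And>i j. i < j \<Longrightarrow> before (r i) (r j)"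
    and far: "\<And>i j. i < j \<Longrightarrow> C < \<rho> * norm (alt (r i \<union> r j))" by blast
  have "norm (alt (r j)) \<le> C''" for j using r by (auto simp: good_def intro: adm_norm)
  then have "\<exists>i j. i < j \<and> norm (alt (r i \<union> r j)) < C'' * \<rho>"
    using C''(2) \<rho>(1) r ord by (intro close_odd_blocks) (auto simp: good_def)
  then obtain i j where "i < j" "norm (alt (r i \<union> r j)) < C'' * \<rho>" by blast
  then have "\<rho> * norm (alt (r i \<union> r j)) < \<rho> * (C'' * \<rho>)" using \<rho>(1) by simp
  also have "\<dots> = C" using C''(3) by (simp add: mult.commute)
  finally have "\<rho> * norm (alt (r i \<union> r j)) < C" .
  with far[OF \<open>i < j\<close>] show False by simp
qed

text \<open>
  By Galvin's lemma it is enough that every infinite \<open>M\<close> contain one infinite set all of whose initial alternating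
  sums are bounded by \<open>C\<close>. This set is the union of blocks found successively by \<open>admissible_extension\<close>.
\<close>

lemma bounded_alternating_sums:
  assumes C: "1 < C" and N: "infinite N"
  shows "\<exists>M\<subseteq>N. infinite M \<and> (\<forall>t. finite t \<longrightarrow> t \<subseteq> M \<longrightarrow> norm (alt t) \<le> C)"
proof -
  consider M where "M \<subseteq> N" "infinite M" "\<And>t. finite t \<Longrightarrow> t \<subseteq> M \<Longrightarrow> \<not> C < norm (alt t)"
    | M where "M \<subseteq> N" "infinite M" "\<And>L. L \<subseteq> M \<Longrightarrow> infinite L \<Longrightarrow> \<exists>n. C < norm (alt (L \<inter> {..<n}))"
    by (rule galvin[OF N, of "\<lambda>t. C < norm (alt t)"]) blast+
  then show ?thesis
  proof cases
    case (1 M)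
    then show ?thesis by (intro exI[of _ M]) (auto simp: not_less)
  next
    case (2 M)
    \<comment> \<open>The bound still required of the future after \<open>k\<close> blocks; it must stay above one and leave room
      for a further extension.\<close>
    define c where "c k = 1 + (C - 1) / (real k + 1)" for k
    have c: "1 < c k" "c (Suc k) < c k" for k
      using C by (auto simp: c_def divide_strict_left_mono)
    define P where "P k z \<longleftrightarrow> finite (fst z) \<and> k \<le> card (fst z) \<and> fst z \<subseteq> M \<and> snd z \<subseteq> M \<and>
      infinite (snd z) \<and> before (fst z) (snd z) \<and>
      (\<forall>t. finite t \<longrightarrow> t \<subseteq> snd z \<longrightarrow> adm (c k) t \<longrightarrow> adm C (fst z \<union> t))"
      for k and z :: "nat set \<times> nat set"
    have "\<exists>z. \<forall>k. P k (z k) \<and> fst (z k) \<subseteq> fst (z (Suc k))"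
    proof (rule dependent_nat_choice)
      have "P 0 ({}, M)" using 2(2) by (auto simp: P_def before_def c_def)
      then show "\<exists>z. P 0 z" ..
    next
      fix z k assume "P k z"
      then have S: "finite (fst z)" "k \<le> card (fst z)" "fst z \<subseteq> M" "snd z \<subseteq> M" "infinite (snd z)"
          "before (fst z) (snd z)"
        and ext: "\<And>t. finite t \<Longrightarrow> t \<subseteq> snd z \<Longrightarrow> adm (c k) t \<Longrightarrow> adm C (fst z \<union> t)"
        by (auto simp: P_def)
      from admissible_extension[OF c(1)[of "Suc k"] c(2)[of k] S(5)]
      obtain s B where s: "finite s" "s \<subseteq> snd z" "odd (card s)" and B: "B \<subseteq> snd z" "infinite B" "before s B"
        and ext': "\<forall>t. finite t \<longrightarrow> t \<subseteq> B \<longrightarrow> adm (c (Suc k)) t \<longrightarrow> adm (c k) (s \<union> t)"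
        by auto
      have "fst z \<inter> s = {}" using S(6) s(2) by (force simp: before_def)
      then have "card (fst z \<union> s) = card (fst z) + card s" using S(1) s(1) by (simp add: card_Un_disjoint)
      moreover have "card s \<noteq> 0" using s(3) by (metis even_zero)
      ultimately have "Suc k \<le> card (fst z \<union> s)" using S(2) by simp
      moreover have "adm C ((fst z \<union> s) \<union> t)" if t: "finite t" "t \<subseteq> B" "adm (c (Suc k)) t" for t
      proof -
        have "adm C (fst z \<union> (s \<union> t))"
          by (rule ext) (use s t B(1) ext' in auto)
        then show ?thesis by (simp only: Un_assoc)
      qed
      moreover have "before (fst z \<union> s) B" using S(6) B(1,3) by (auto simp: before_def)
      moreover have "fst z \<union> s \<subseteq> M" "B \<subseteq> M" "finite (fst z \<union> s)" using S s B by auto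
      ultimately have "P (Suc k) (fst z \<union> s, B)" using B(2) unfolding P_def by simp
      then show "\<exists>z'. P (Suc k) z' \<and> fst z \<subseteq> fst z'"
        by (intro exI[of _ "(fst z \<union> s, B)"]) simp
    qed
    then obtain z where "\<forall>k. P k (z k) \<and> fst (z k) \<subseteq> fst (z (Suc k))" ..
    then have z: "P k (z k)" and z_Suc: "fst (z k) \<subseteq> fst (z (Suc k))" for k by simp_all
    define S where "S k = fst (z k)" for k
    have S: "finite (S k)" "k \<le> card (S k)" "S k \<subseteq> M" for k
      using z[of k] by (auto simp: S_def P_def)
    have S_adm: "adm C (S k)" for k
    proof -
      have "0 \<le> c k" using c(1)[of k] by simp
      then have "adm (c k) {}" by (simp add: adm_def)
      then have "adm C (fst (z k) \<union> {})" using z[of k] unfolding P_def by blast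
      then show ?thesis by (simp add: S_def)
    qed
    have S_mono: "S i \<subseteq> S j" if "i \<le> j" for i j
      unfolding S_def by (rule lift_Suc_mono_le[of "\<lambda>k. fst (z k)", OF z_Suc that])
    define L where "L = (\<Union>k. S k)"
    have "infinite L"
    proof
      assume fin: "finite L"
      have "S (Suc (card L)) \<subseteq> L" by (auto simp: L_def)
      then have "card (S (Suc (card L))) \<le> card L" by (rule card_mono[OF fin])
      then show False using S(2)[of "Suc (card L)"] by simp
    qed
    moreover have "L \<subseteq> M" using S(3) by (auto simp: L_def)
    ultimately obtain n where n: "C < norm (alt (L \<inter> {..<n}))" using 2(3) by blast
    have "\<exists>k. F \<subseteq> S k" if "finite F" "F \<subseteq> L" for F
      using that
    proof induction
      case (insert a F)
      then obtain k where "F \<subseteq> S k" by auto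
      moreover obtain j where "a \<in> S j" using insert.prems by (auto simp: L_def)
      ultimately have "insert a F \<subseteq> S (max k j)"
        using S_mono[of k "max k j"] S_mono[of j "max k j"] by auto
      then show ?case ..
    qed simp
    then obtain k where k: "L \<inter> {..<n} \<subseteq> S k" by (metis finite_Int finite_lessThan inf_le1)
    have "L \<inter> {..<n} = S k \<inter> {..<n}" using k by (auto simp: L_def)
    then have False using n adm_initial[OF S_adm, of k n] by simp
    then show ?thesis ..
  qed
qed

section \<open>Alternating sums bounded below two\<close>

text \<open>
  In \<open>y n = alt (T n) - x (l (2 * n))\<close> the last two signs are as in \<open>\<dots> - x (l (2 * n - 1)) - x (l (2 * n))\<close>,
  so this is not an alternating sum. It becomes one when an index \<open>c\<close> with a plus sign is inserted before the last term;
  the sequence \<open>l\<close> leaves enough space to average the inserted vector away. For \<open>m < n\<close> the vector \<open>x (l (2 * m))\<close>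
  has coefficient \<open>-1\<close> in \<open>y m\<close> and \<open>1\<close> in \<open>y n\<close>, and the terms before it cancel in
  \<open>y n - y m\<close>, whence the distance is almost two.
\<close>

theorem unseparated_sequence_impossible: False
proof -
  have "(1::real) < 11/10" by simp
  from initial_sum_bound[OF this]
  obtain n0 where n0: "\<forall>t n a. finite t \<and> t \<subseteq> {n0..} \<longrightarrow>
      norm (\<Sum>i\<in>t \<inter> {..<n}. a i *\<^sub>R x i) \<le> 11/10 * norm (\<Sum>i\<in>t. a i *\<^sub>R x i)" ..
  have "infinite {n0..}" by (rule infinite_Ici)
  from bounded_alternating_sums[OF _ this, of "5/4"]
  obtain M where M: "M \<subseteq> {n0..}" "infinite M"
    and bounded: "\<And>t. finite t \<Longrightarrow> t \<subseteq> M \<Longrightarrow> norm (alt t) \<le> 5/4"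
    by auto
  define P where "P l i v \<longleftrightarrow> v \<in> M \<and> (\<forall>j<i. l j < v) \<and>
    (\<exists>A y. finite A \<and> A \<subseteq> M \<and> (\<forall>c\<in>A. c < v \<and> (\<forall>j<i. l j < c)) \<and> y \<in> convex hull (x ` A) \<and> norm y < 1/4)"
    for l :: "nat \<Rightarrow> nat" and i v
  have "\<exists>l. \<forall>i. P l i (l i)"
  proof (rule dependent_wellorder_choice)
    show "P l i v = P l' i v" if "\<And>j. j < i \<Longrightarrow> l j = l' j" for l l' i v
      using that by (simp add: P_def)
  next
    fix l :: "nat \<Rightarrow> nat" and i
    have "infinite {m\<in>M. \<forall>k\<in>l ` {..<i}. k < m}" by (rule infinite_tail[OF M(2)]) simp
    from small_convex_combination[OF this, of "1/4"]
    obtain A y where A: "finite A" "A \<subseteq> {m\<in>M. \<forall>k\<in>l ` {..<i}. k < m}" "y \<in> convex hull (x ` A)" "norm y < 1/4"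
      by auto
    have "infinite {m\<in>M. \<forall>k\<in>A \<union> l ` {..<i}. k < m}"
      by (rule infinite_tail[OF M(2)]) (use A(1) in simp)
    then obtain v where "v \<in> {m\<in>M. \<forall>k\<in>A \<union> l ` {..<i}. k < m}" by (metis ex_in_conv finite.emptyI)
    then have "P l i v" unfolding P_def using A by (intro conjI exI[of _ A] exI[of _ y]) auto
    then show "\<exists>v. P l i v" ..
  qed
  then obtain l where l: "\<forall>i. P l i (l i)" ..
  have l_M: "l i \<in> M" for i using l by (simp add: P_def)
  have l_less: "l j < l i" if "j < i" for i j using l that by (simp add: P_def)
  then have l_mono: "strict_mono l" by (simp add: strict_mono_def)
  have l_inj: "inj_on l A" for A using strict_mono_imp_inj_on[OF l_mono] inj_on_subset by blast
  define T where "T n = l ` {..<2 * n}" for n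
  have T: "finite (T n)" "T n \<subseteq> M" "card (T n) = 2 * n" for n
    using l_M by (auto simp: T_def card_image[OF l_inj])
  define y where "y n = alt (T n) - x (l (2 * n))" for n
  have y_bound: "norm (y n) \<le> 3/2" for n
  proof -
    obtain A v where A: "A \<subseteq> M" "\<And>c. c \<in> A \<Longrightarrow> c < l (2 * n)" "\<And>c k. c \<in> A \<Longrightarrow> k \<in> T n \<Longrightarrow> k < c"
      and v: "v \<in> convex hull (x ` A)" "norm v < 1/4"
      using spec[OF l, of "2 * n"] unfolding P_def T_def by fastforce
    have "x ` A \<subseteq> cball (- y n) (5/4)"
    proof
      fix u assume "u \<in> x ` A"
      then obtain c where c: "c \<in> A" "u = x c" by blast
      have fresh: "\<forall>k\<in>T n. k < c" using A(3) c(1) by blast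
      have cn: "c < l (2 * n)" by (rule A(2)[OF c(1)])
      have "card (insert c (T n)) = Suc (2 * n)" using T fresh by (subst card_insert_disjoint) auto
      moreover have "\<forall>k\<in>insert c (T n). k < l (2 * n)" using fresh cn by auto
      ultimately have "alt (insert (l (2 * n)) (insert c (T n))) = alt (insert c (T n)) - x (l (2 * n))"
        using alt_insert[of "insert c (T n)" "l (2 * n)"] T(1) by simp
      also have "alt (insert c (T n)) = alt (T n) + x c"
        using alt_insert[OF T(1) fresh] T(3) by simp
      finally have "alt (insert (l (2 * n)) (insert c (T n))) = y n + u"
        by (simp add: y_def c(2))
      moreover have "norm (alt (insert (l (2 * n)) (insert c (T n)))) \<le> 5/4"
        by (rule bounded) (use T l_M A(1) c(1) in auto)
      moreover have "dist (- y n) u = norm (y n + u)"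
        using norm_minus_cancel[of "y n + u"] by (simp add: dist_norm)
      ultimately show "u \<in> cball (- y n) (5/4)" by simp
    qed
    then have "v \<in> cball (- y n) (5/4)" using v(1) hull_minimal[of "x ` A" _ convex] convex_cball by blast
    then have "norm (- y n - v) \<le> 5/4" by (simp add: dist_norm)
    then show ?thesis using norm_triangle_ineq[of "- y n - v" v] v(2) by simp
  qed
  have y_sep: "9/5 \<le> norm (y m - y n)" if mn: "m < n" for m n
  proof -
    define U where "U = l ` {2 * m..<2 * n}"
    have U: "finite U" "U \<subseteq> M" using l_M by (auto simp: U_def)
    have "T n = T m \<union> U"
      using mn unfolding T_def U_def by (metis image_Un ivl_disj_un_one(2) less_imp_le mult_le_mono2)
    moreover have "before (T m) U" using l_less by (auto simp: before_def T_def U_def)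
    ultimately have alt_T: "alt (T n) = alt (T m) + alt U"
      using alt_Un[OF T(1)[of m] U(1)] T(3) by simp
    \<comment> \<open>The coefficients of \<open>y n - y m\<close>.\<close>
    define a where "a i = (if i = l (2 * n) then -1 else (-1) ^ card {j\<in>U. j < i} + (if i = l (2 * m) then 1 else 0) :: real)" for i
    have lU: "l (2 * m) \<in> U" using mn by (simp add: U_def)
    have nU: "l (2 * n) \<notin> U" using l_less by (fastforce simp: U_def)
    have "(\<Sum>i\<in>insert (l (2 * n)) U. a i *\<^sub>R x i) = - x (l (2 * n)) + (\<Sum>i\<in>U. a i *\<^sub>R x i)"
      using U(1) nU by (simp add: a_def)
    also have "(\<Sum>i\<in>U. a i *\<^sub>R x i) = (\<Sum>i\<in>U. (-1) ^ card {j\<in>U. j < i} *\<^sub>R x i + (if i = l (2 * m) then x i else 0))"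
      using nU by (intro sum.cong) (auto simp: a_def scaleR_add_left)
    also have "\<dots> = alt U + x (l (2 * m))"
      using U(1) lU by (simp add: sum.distrib alt_def)
    finally have total: "(\<Sum>i\<in>insert (l (2 * n)) U. a i *\<^sub>R x i) = y n - y m"
      by (simp add: y_def alt_T)
    have "k = l (2 * m)" if "k \<in> U" "k \<le> l (2 * m)" for k
      using that strict_mono_less_eq[OF l_mono] by (auto simp: U_def)
    then have "U \<inter> {..<Suc (l (2 * m))} = {l (2 * m)}"
      using lU by (auto simp: less_Suc_eq_le)
    moreover have "l (2 * m) < l (2 * n)" using l_less mn by simp
    ultimately have initial: "insert (l (2 * n)) U \<inter> {..<Suc (l (2 * m))} = {l (2 * m)}" by auto
    have first: "{j\<in>U. j < l (2 * m)} = {}" using strict_mono_less[OF l_mono] by (auto simp: U_def)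
    have "a (l (2 * m)) = 2" using \<open>l (2 * m) < l (2 * n)\<close> unfolding a_def first by simp
    then have "2 = norm (\<Sum>i\<in>insert (l (2 * n)) U \<inter> {..<Suc (l (2 * m))}. a i *\<^sub>R x i)"
      unfolding initial by (simp add: norm_x)
    also have "\<dots> \<le> 11/10 * norm (y n - y m)"
      unfolding total[symmetric] using U l_M M(1) by (intro n0[rule_format]) auto
    finally show ?thesis by (simp add: norm_minus_commute)
  qed
  from coordinates_of_alt obtain g :: "nat \<Rightarrow> 'a \<Rightarrow>\<^sub>L real" where "\<forall>k. norm (g k) \<le> 4 \<and>
    (\<forall>i. blinfun_apply (g k) (x i) = (if i = k then 1 else 0)) \<and>
    (\<forall>t. finite t \<longrightarrow> blinfun_apply (g k) (alt t) = (if k \<in> t then (-1) ^ card {j\<in>t. j < k} else 0))" ..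
  then have g: "\<And>k. norm (g k) \<le> 4"
    "\<And>k i. blinfun_apply (g k) (x i) = (if i = k then 1 else 0)"
    "\<And>k t. finite t \<Longrightarrow> blinfun_apply (g k) (alt t) = (if k \<in> t then (-1) ^ card {j\<in>t. j < k} else 0)"
    by simp_all
  have g_y: "g (l (2 * m)) (y k) = (if m < k then 1 else if k = m then -1 else 0)" for m k
  proof -
    have mem: "l (2 * m) \<in> T k \<longleftrightarrow> m < k"
      using inj_on_eq_iff[OF l_inj[of UNIV]] by (auto simp: T_def)
    have eq: "l (2 * k) = l (2 * m) \<longleftrightarrow> k = m"
      using inj_on_eq_iff[OF l_inj[of UNIV]] by auto
    have "{j\<in>T k. j < l (2 * m)} = T m" if "m < k"
      using that strict_mono_less[OF l_mono] by (auto simp: T_def)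
    then have "(-1 :: real) ^ card {j\<in>T k. j < l (2 * m)} = 1" if "m < k"
      using that T(3)[of m] by simp
    then show ?thesis
      using mem eq by (simp add: y_def blinfun.diff_right g(2) g(3)[OF T(1)])
  qed
  have "1 < Ka TYPE('a)"
  proof (rule Ka_gt_one_if_separated[where y = y and R = "3/2" and \<delta> = "1/5" and G = 16])
    show "3/2 * (1 + 1/5) \<le> norm (y m - y n)" if "m < n" for m n
      using y_sep[OF that] by simp
  next
    fix m n :: nat assume mn: "m < n"
    \<comment> \<open>On \<open>y m\<close> and \<open>y n\<close> the values are \<open>3\<close> and \<open>- 4\<close>, on the other terms \<open>0\<close>, \<open>- 3\<close>
      (between \<open>m\<close> and \<open>n\<close>) and \<open>- 2\<close> (beyond \<open>n\<close>). The weight must exceed one because the coordinate at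
      \<open>l (2 * n)\<close> has opposite signs on \<open>y n\<close> and beyond.\<close>
    define h where "h = g (l (2 * n)) - 3 *\<^sub>R g (l (2 * m))"
    have "norm h \<le> norm (g (l (2 * n))) + norm (3 *\<^sub>R g (l (2 * m)))"
      unfolding h_def by (rule norm_triangle_ineq4)
    also have "\<dots> \<le> 16" using g(1)[of "l (2 * n)"] g(1)[of "l (2 * m)"] by simp
    finally have "norm h \<le> 16" .
    moreover have "h (y k) = (if n < k then 1 else if k = n then -1 else 0)
        - 3 * (if m < k then 1 else if k = m then -1 else 0)" for k
      by (simp add: h_def blinfun.diff_left blinfun.scaleR_left g_y)
    ultimately show "\<exists>h :: 'a \<Rightarrow>\<^sub>L real. norm h \<le> 16 \<and>
        (\<forall>k. k \<noteq> m \<longrightarrow> blinfun_apply h (y k) + 1 \<le> blinfun_apply h (y m)) \<and>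
        (\<forall>k. k \<noteq> n \<longrightarrow> blinfun_apply h (y n) + 1 \<le> blinfun_apply h (y k))"
      using mn by (intro exI[of _ h]) auto
  qed (use y_bound in auto)
  then show False using Ka_le_one by simp
qed

end

theorem corollary1p9:
  assumes "infinite_dimensional TYPE('a::banach)"
    and "separable_space (euclidean :: ('a \<Rightarrow>\<^sub>L real) topology)"
  shows "Ka TYPE('a) > 1"
proof (rule ccontr)
  assume Ka: "\<not> ?thesis"
  obtain x :: "nat \<Rightarrow> 'a" where x: "basic_null_sequence x"
    by (rule basic_null_sequence_exists[OF assms])
  interpret basic_null_sequence x by (rule x)
  interpret unseparated_sequence x by unfold_locales (use Ka in simp)
  show False by (rule unseparated_sequence_impossible)
qed

end
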